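(* Let $T$ and $T'$ be doubly commuting contractions on a complex Hilbert space $\mathcal{H}$ such that $T$ is quasi-normal and $T$ is Harnack dominated by $T'$. Then $T$ and $T'$ are Shmul'yan equivalent.
   Context: A contraction is a bounded linear operator of norm at most $1$; $\operatorname{Re}A=\frac12(A+A^* )$. Operators $A,B$ are doubly commuting if $A$ commutes with $B$ and with $B^*$. $A$ is quasi-normal if it commutes with $A^*A$. For a contraction $A$, $D_A=(I-A^*A)^{1/2}$ and $\mathcal{D}_A=\overline{\mathcal{R}(D_A)}$. Harnack domination: for contractions $T,T'$ on the same Hilbert space, $T$ is Harnack dominated by $T'$ if there is a constant $c\ge 1$ such that $\operatorname{Re}p(T)\le c\,\operatorname{Re}p(T')$ for every analytic polynomial $p$ with $\operatorname{Re}p(z)\ge 0$ for $|z|\le 1$. Shmul'yan domination: for contractions $A,B$, $A$ Shmul'yan dominates $B$ if $B=A+D_{A^*}XD_A$ for some bounded $X\in\mathcal{B}(\mathcal{D}_A,\mathcal{D}_{A^*})$. $A$ and $B$ are Shmul'yan equivalent if each Shmul'yan dominates the other. *)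

theory Defs
  imports "HOL-Analysis.Analysis" "HOL-Computational_Algebra.Polynomial"
begin

text \<open>A complex Hilbert space is in particular a real Hilbert space for the real part of its
  inner product, and its norm is the one of that real structure.  Hence the class extends
  \<open>real_inner\<close> and \<open>banach\<close>; positive definiteness and \<open>norm x = sqrt (Re (cinner x x))\<close>
  are inherited from \<open>real_inner\<close> via the last axiom.  The inner product is linear in its
  first argument.\<close>

class complex_hilbert_space = real_inner + banach +
  fixes scaleC :: "complex \<Rightarrow> 'a \<Rightarrow> 'a" (infixr \<open>*\<^sub>C\<close> 75)
    and cinner :: "'a \<Rightarrow> 'a \<Rightarrow> complex"
  assumes scaleC_add_right: "a *\<^sub>C (x + y) = a *\<^sub>C x + a *\<^sub>C y"
    and scaleC_add_left: "(a + b) *\<^sub>C x = a *\<^sub>C x + b *\<^sub>C x"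
    and scaleC_scaleC: "a *\<^sub>C b *\<^sub>C x = (a * b) *\<^sub>C x"
    and scaleC_of_real: "complex_of_real r *\<^sub>C x = r *\<^sub>R x"
    and cinner_commute: "cinner x y = cnj (cinner y x)"
    and cinner_add_left: "cinner (x + y) z = cinner x z + cinner y z"
    and cinner_scaleC_left: "cinner (a *\<^sub>C x) y = a * cinner x y"
    and inner_eq_Re_cinner: "inner x y = Re (cinner x y)"

instantiation complex :: complex_hilbert_space
begin

definition scaleC_complex :: "complex \<Rightarrow> complex \<Rightarrow> complex"
  where "scaleC_complex a x = a * x"

definition cinner_complex :: "complex \<Rightarrow> complex \<Rightarrow> complex"
  where "cinner_complex x y = x * cnj y"

instance
  by standard
    (auto simp: scaleC_complex_def cinner_complex_def algebra_simps scaleR_conv_of_real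
      inner_complex_def)

end

definition bounded_clinear :: "('a::complex_hilbert_space \<Rightarrow> 'a) \<Rightarrow> bool"
  where "bounded_clinear A \<longleftrightarrow> bounded_linear A \<and> (\<forall>a x. A (a *\<^sub>C x) = a *\<^sub>C A x)"

definition contraction :: "('a::complex_hilbert_space \<Rightarrow> 'a) \<Rightarrow> bool"
  where "contraction A \<longleftrightarrow> bounded_clinear A \<and> onorm A \<le> 1"

definition cadjoint :: "('a::complex_hilbert_space \<Rightarrow> 'a) \<Rightarrow> 'a \<Rightarrow> 'a"
  where "cadjoint A = (THE B. \<forall>x y. cinner (A x) y = cinner x (B y))"

definition positive_op :: "('a::complex_hilbert_space \<Rightarrow> 'a) \<Rightarrow> bool"
  where "positive_op A \<longleftrightarrow>
    bounded_clinear A \<and> (\<forall>x. cinner (A x) x \<in> \<real> \<and> 0 \<le> Re (cinner (A x) x))"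

definition le_op :: "('a::complex_hilbert_space \<Rightarrow> 'a) \<Rightarrow> ('a \<Rightarrow> 'a) \<Rightarrow> bool"
  where "le_op A B \<longleftrightarrow> positive_op (\<lambda>x. B x - A x)"

definition sqrt_op :: "('a::complex_hilbert_space \<Rightarrow> 'a) \<Rightarrow> 'a \<Rightarrow> 'a"
  where "sqrt_op A = (THE B. positive_op B \<and> B \<circ> B = A)"

definition Re_op :: "('a::complex_hilbert_space \<Rightarrow> 'a) \<Rightarrow> 'a \<Rightarrow> 'a"
  where "Re_op A = (\<lambda>x. (1/2) *\<^sub>R (A x + cadjoint A x))"

definition poly_op :: "complex poly \<Rightarrow> ('a::complex_hilbert_space \<Rightarrow> 'a) \<Rightarrow> 'a \<Rightarrow> 'a"
  where "poly_op p A = (\<lambda>x. \<Sum>k\<le>degree p. coeff p k *\<^sub>C (A ^^ k) x)"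

definition doubly_commuting :: "('a::complex_hilbert_space \<Rightarrow> 'a) \<Rightarrow> ('a \<Rightarrow> 'a) \<Rightarrow> bool"
  where "doubly_commuting A B \<longleftrightarrow> A \<circ> B = B \<circ> A \<and> A \<circ> cadjoint B = cadjoint B \<circ> A"

definition quasi_normal :: "('a::complex_hilbert_space \<Rightarrow> 'a) \<Rightarrow> bool"
  where "quasi_normal A \<longleftrightarrow> A \<circ> (cadjoint A \<circ> A) = (cadjoint A \<circ> A) \<circ> A"

definition defect_op :: "('a::complex_hilbert_space \<Rightarrow> 'a) \<Rightarrow> 'a \<Rightarrow> 'a"
  where "defect_op A = sqrt_op (\<lambda>x. x - cadjoint A (A x))"

definition defect_space :: "('a::complex_hilbert_space \<Rightarrow> 'a) \<Rightarrow> 'a set"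
  where "defect_space A = closure (range (defect_op A))"

definition harnack_dominated ::
    "('a::complex_hilbert_space \<Rightarrow> 'a) \<Rightarrow> ('a \<Rightarrow> 'a) \<Rightarrow> bool"
  where "harnack_dominated T T' \<longleftrightarrow>
    (\<exists>c\<ge>1. \<forall>p. (\<forall>z. cmod z \<le> 1 \<longrightarrow> 0 \<le> Re (poly p z)) \<longrightarrow>
      le_op (Re_op (poly_op p T)) (\<lambda>x. c *\<^sub>R Re_op (poly_op p T') x))"

text \<open>Bounded operators from the subspace \<open>V\<close> to the subspace \<open>W\<close>, represented by total
  functions whose values outside \<open>V\<close> are irrelevant.\<close>

definition bounded_clinear_between ::
    "'a::complex_hilbert_space set \<Rightarrow> 'a set \<Rightarrow> ('a \<Rightarrow> 'a) \<Rightarrow> bool"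
  where "bounded_clinear_between V W X \<longleftrightarrow>
    (\<forall>x\<in>V. X x \<in> W) \<and>
    (\<forall>x\<in>V. \<forall>y\<in>V. X (x + y) = X x + X y) \<and>
    (\<forall>a. \<forall>x\<in>V. X (a *\<^sub>C x) = a *\<^sub>C X x) \<and>
    (\<exists>K. \<forall>x\<in>V. norm (X x) \<le> K * norm x)"

definition shmulyan_dominates ::
    "('a::complex_hilbert_space \<Rightarrow> 'a) \<Rightarrow> ('a \<Rightarrow> 'a) \<Rightarrow> bool"
  where "shmulyan_dominates A B \<longleftrightarrow>
    (\<exists>X. bounded_clinear_between (defect_space A) (defect_space (cadjoint A)) X \<and>
      (\<forall>x. B x = A x + defect_op (cadjoint A) (X (defect_op A x))))"

definition shmulyan_equivalent ::
    "('a::complex_hilbert_space \<Rightarrow> 'a) \<Rightarrow> ('a \<Rightarrow> 'a) \<Rightarrow> bool"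
  where "shmulyan_equivalent A B \<longleftrightarrow> shmulyan_dominates A B \<and> shmulyan_dominates B A"

end

theory Submission
  imports Defs
begin

text \<open>Everything reduces to bounds for the real form \<open>\<langle>x, y\<rangle>\<close>: \<open>A\<close> Shmul'yan dominates
  \<open>B\<close> as soon as \<open>\<bar>\<langle>(B - A) x, y\<rangle>\<bar> \<le> K \<parallel>D\<^sub>A x\<parallel> \<parallel>D y\<parallel>\<close>, where \<open>D\<close> is the defect operator
  of the adjoint of \<open>A\<close>.

  Averaging the Harnack inequality for rotated Fejer polynomials over roots of unity gives
  \<open>\<Sum> \<langle>T\<^bsub>i-j\<^esub> h\<^sub>j, h\<^sub>i\<rangle> \<le> c \<Sum> \<langle>T'\<^bsub>i-j\<^esub> h\<^sub>j, h\<^sub>i\<rangle>\<close> for all finite sequences \<open>h\<close>, where \<open>T\<^sub>n\<close> is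
  \<open>T\<^sup>n\<close> for \<open>n \<ge> 0\<close> and the adjoint of \<open>T\<^bsup>-n\<^esup>\<close> for \<open>n < 0\<close>.  Sequences of length two show that the
  defect operators of \<open>T\<close> and of its adjoint are dominated by those of \<open>T'\<close> and its adjoint.

  Put \<open>P = T\<^sup>* T\<close> and \<open>W = T' T\<^sup>*\<close>.  The sequence \<open>h\<^sub>n = r\<^sup>n T\<^sup>n (1 - r W) (1 - r\<^sup>2 P) g\<close> turns both sides
  into telescoping sums, by quasi-normality on the left and double commutation on the right.
  Infinite length and then \<open>r \<rightarrow> 1\<close> give \<open>\<parallel>(1 - W) g\<parallel> \<le> 2 c \<parallel>(1 - P) g\<parallel>\<close>.  As \<open>W\<close> commutes with
  \<open>D\<^sub>T = (1 - P)\<^bsup>1/2\<^esup>\<close>, this becomes \<open>\<bar>\<langle>(1 - W) x, y\<rangle>\<bar> \<le> 2 c \<parallel>D\<^sub>T x\<parallel> \<parallel>D\<^sub>T y\<parallel>\<close>.  Now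
  \<open>T - T' = (1 - W) T - T' D\<^sub>T\<^sup>2\<close>, and \<open>D\<^sub>T\<close> is dominated by the defect operator of the adjoint since
  quasi-normal operators are hyponormal.\<close>

section \<open>Representation of functionals on ranges\<close>

text \<open>A nonzero slope at \<open>t = 0\<close> would push the quadratic below its value there.
  This is the first-order condition used below for minimising sequences and for kernels of positive
  forms.\<close>

lemma linear_coefficient_zero:
  fixes d b :: real
  assumes "\<And>t. 0 \<le> 2 * t * d + t\<^sup>2 * b" and b: "0 \<le> b"
  shows "d = 0"
proof -
  \<comment> \<open>The exact minimiser is \<open>- d / b\<close>; the denominator
    \<open>b + 1\<close> also covers \<open>b = 0\<close>.\<close>
  have "0 \<le> 2 * (- d / (b + 1)) * d + (- d / (b + 1))\<^sup>2 * b" by (rule assms(1))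
  also have "\<dots> = - (d\<^sup>2 * (b + 2) / (b + 1)\<^sup>2)"
    using b by (simp add: divide_simps) (simp add: algebra_simps power2_eq_square)
  finally have "d\<^sup>2 * (b + 2) / (b + 1)\<^sup>2 \<le> 0" by simp
  then have "d\<^sup>2 * (b + 2) \<le> 0" using b by (simp add: divide_le_0_iff)
  then show ?thesis using b by (simp add: mult_le_0_iff)
qed

text \<open>Riesz representation for a functional controlled by \<open>S\<close>: a minimising
  sequence of \<open>J\<close> has convergent images under \<open>S\<close>, and their limit
  represents the functional. Since the range may fail to be closed, the limit is only placed in its
  closure.\<close>

lemma representation_on_range:
  fixes S :: "'b::real_vector \<Rightarrow> 'a::{real_inner,complete_space}" and \<phi> :: "'b \<Rightarrow> real"
  assumes S: "linear S" and \<phi>: "linear \<phi>"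
    and bound: "\<And>x. \<bar>\<phi> x\<bar> \<le> K * norm (S x)" and K: "0 \<le> K"
  obtains z where "z \<in> closure (range S)" "norm z \<le> K" "\<And>x. \<phi> x = inner (S x) z"
proof -
  define J where "J x = (norm (S x))\<^sup>2 - 2 * \<phi> x" for x
  have J_lower: "- K\<^sup>2 \<le> J x" for x
  proof -
    have "2 * \<phi> x \<le> 2 * (K * norm (S x))" using bound[of x] by linarith
    also have "\<dots> \<le> K\<^sup>2 + (norm (S x))\<^sup>2"
      using sum_squares_bound[of K "norm (S x)"] by simp
    finally show ?thesis by (simp add: J_def)
  qed
  define m where "m = Inf (range J)"
  have bdd: "bdd_below (range J)" using J_lower by (auto intro!: bdd_belowI)
  have m_le: "m \<le> J x" for x unfolding m_def by (intro cInf_lower bdd) auto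
  have "\<exists>x. J x < m + 1 / real (Suc n)" for n
  proof -
    have "Inf (range J) < m + 1 / real (Suc n)" by (simp add: m_def)
    then show ?thesis using cInf_lessD[of "range J"] by auto
  qed
  then obtain X where X: "\<And>n. J (X n) < m + 1 / real (Suc n)" by metis
  \<comment> \<open>Parallelogram law: as \<open>J\<close> is at least \<open>m\<close> at the
    midpoint, two almost-minimisers have nearby images under \<open>S\<close>.\<close>
  have par: "(norm (S a - S b))\<^sup>2 = 2 * J a + 2 * J b - 4 * J ((1/2) *\<^sub>R (a + b))" for a b
    using S \<phi>
    by (simp add: J_def linear_add linear_cmul power2_norm_eq_inner
        inner_add_left inner_add_right inner_diff_left inner_diff_right inner_commute)
  have dist_bound: "(norm (S (X i) - S (X j)))\<^sup>2 \<le> 4 / real (Suc n)" if "n \<le> i" "n \<le> j" for i j n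
  proof -
    have "1 / real (Suc i) \<le> 1 / real (Suc n)" "1 / real (Suc j) \<le> 1 / real (Suc n)"
      using that by (simp_all add: frac_le)
    then have "J (X i) \<le> m + 1 / real (Suc n)" "J (X j) \<le> m + 1 / real (Suc n)"
      using X[of i] X[of j] by linarith+
    then show ?thesis
      using par[of "X i" "X j"] m_le[of "(1/2) *\<^sub>R (X i + X j)"] by linarith
  qed
  have "Cauchy (\<lambda>n. S (X n))"
  proof (rule metric_CauchyI)
    fix e :: real assume e: "0 < e"
    obtain n where n: "4 / e\<^sup>2 < real n" using reals_Archimedean2 by blast
    have "4 / real (Suc n) < e\<^sup>2"
    proof -
      have "4 < e\<^sup>2 * real n" using n e by (simp add: field_simps)
      also have "\<dots> \<le> e\<^sup>2 * real (Suc n)" by (intro mult_left_mono) auto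
      finally show ?thesis by (simp add: divide_less_eq)
    qed
    then have "dist (S (X i)) (S (X j)) < e" if "n \<le> i" "n \<le> j" for i j
      using le_less_trans[OF dist_bound[OF that]] e
      by (simp add: dist_norm power2_less_imp_less)
    then show "\<exists>M. \<forall>i\<ge>M. \<forall>j\<ge>M. dist (S (X i)) (S (X j)) < e" by blast
  qed
  then obtain z where z: "(\<lambda>n. S (X n)) \<longlonglongrightarrow> z"
    using Cauchy_convergent_iff convergent_def by blast
  have JX: "(\<lambda>n. J (X n)) \<longlonglongrightarrow> m"
  proof (rule tendsto_sandwich[OF _ _ tendsto_const])
    show "\<forall>\<^sub>F n in sequentially. m \<le> J (X n)" using m_le by simp
    show "\<forall>\<^sub>F n in sequentially. J (X n) \<le> m + 1 / real (Suc n)"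
      using X by (simp add: less_imp_le)
    show "(\<lambda>n. m + 1 / real (Suc n)) \<longlonglongrightarrow> m"
      using tendsto_add[OF tendsto_const LIMSEQ_inverse_real_of_nat, of m]
      by (simp add: inverse_eq_divide)
  qed
  have rep: "\<phi> x = inner (S x) z" for x
  proof -
    define d where "d = inner z (S x) - \<phi> x"
    \<comment> \<open>Perturb the minimising sequence in direction \<open>x\<close> and pass to the
      limit: the first variation of \<open>J\<close> vanishes at \<open>z\<close>.\<close>
    have ineq: "0 \<le> 2 * t * d + t\<^sup>2 * (norm (S x))\<^sup>2" for t
    proof -
      have "J (X n + t *\<^sub>R x) = J (X n) + 2 * t * (inner (S (X n)) (S x) - \<phi> x)
          + t\<^sup>2 * (norm (S x))\<^sup>2" for n
        using S \<phi>
        by (simp add: J_def linear_add linear_cmul power2_norm_eq_inner inner_add_left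
            inner_add_right inner_commute)
          (simp add: algebra_simps power2_eq_square)
      then have "m \<le> J (X n) + 2 * t * (inner (S (X n)) (S x) - \<phi> x)
          + t\<^sup>2 * (norm (S x))\<^sup>2" for n
        by (metis m_le)
      moreover have "(\<lambda>n. J (X n) + 2 * t * (inner (S (X n)) (S x) - \<phi> x)
          + t\<^sup>2 * (norm (S x))\<^sup>2) \<longlonglongrightarrow> m + 2 * t * d + t\<^sup>2 * (norm (S x))\<^sup>2"
        unfolding d_def by (intro tendsto_intros JX z)
      ultimately have "m \<le> m + 2 * t * d + t\<^sup>2 * (norm (S x))\<^sup>2"
        by (intro LIMSEQ_le_const) auto
      then show ?thesis by simp
    qed
    have "d = 0" by (rule linear_coefficient_zero[OF ineq]) simp
    then show ?thesis by (simp add: d_def inner_commute)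
  qed
  \<comment> \<open>Testing the bound on the minimising sequence gives
    \<open>|z|^2 \<le> K |z|\<close> in the limit.\<close>
  have "inner (S (X n)) z \<le> K * norm (S (X n))" for n
    using bound[of "X n"] rep[of "X n"] by simp
  then have "inner z z \<le> K * norm z"
    by (intro LIMSEQ_le[of "\<lambda>n. inner (S (X n)) z" _ "\<lambda>n. K * norm (S (X n))"])
      (auto intro!: tendsto_intros z)
  then have "norm z * norm z \<le> K * norm z"
    by (simp add: power2_norm_eq_inner[symmetric] power2_eq_square)
  then have "norm z \<le> K" using K by (cases "norm z = 0") auto
  moreover have "z \<in> closure (range S)"
    unfolding closure_sequential using z by (intro exI[of _ "\<lambda>n. S (X n)"]) auto
  ultimately show ?thesis using rep by (intro that)
qed

text \<open>\<open>z\<close> is the orthogonal projection of \<open>y\<close> onto the closed range,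
  obtained as the representer of \<open>inner (S x) y\<close>. The remainder is orthogonal to the
  range, hence invisible to the adjoint.\<close>

lemma kernel_range_decomposition:
  fixes S :: "'b::real_inner \<Rightarrow> 'a::{real_inner,complete_space}"
  assumes S: "linear S" and adj: "\<And>x y. inner (S x) y = inner x (S' y)"
  obtains z where "z \<in> closure (range S)" "S' y = S' z" "\<And>x. inner (S x) (y - z) = 0"
proof -
  have "linear (\<lambda>x. inner (S x) y)"
    using S by (intro linearI) (simp_all add: linear_add linear_cmul inner_add_left)
  then obtain z where z: "z \<in> closure (range S)" "\<And>x. inner (S x) y = inner (S x) z"
    using representation_on_range[OF S, of "\<lambda>x. inner (S x) y" "norm y"]
    by (metis Cauchy_Schwarz_ineq2 mult.commute norm_ge_zero)
  have "inner (S' y - S' z) (S' y - S' z) = 0"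
    using z(2)[of "S' y - S' z"] by (simp add: adj inner_diff_right)
  then have "S' y = S' z" by (simp only: inner_eq_zero_iff right_minus_eq)
  then show ?thesis using z by (intro that[of z]) (simp_all add: inner_diff_right)
qed

section \<open>Adjoints\<close>

lemma scaleC_minus_one [simp]: "(-1) *\<^sub>C x = - (x::'a::complex_hilbert_space)"
  using scaleC_of_real[of "-1" x] by simp

lemma scaleC_one [simp]: "1 *\<^sub>C x = (x::'a::complex_hilbert_space)"
  using scaleC_of_real[of 1 x] by simp

lemma cinner_scaleC_right: "cinner x (a *\<^sub>C y) = cnj a * cinner x (y::'a::complex_hilbert_space)"
  by (simp add: cinner_commute[of x] cinner_scaleC_left)

lemma Im_cinner: "Im (cinner x y) = - inner (\<i> *\<^sub>C x) (y::'a::complex_hilbert_space)"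
  by (simp add: inner_eq_Re_cinner cinner_scaleC_left)

lemma inner_scaleC_left: "inner (a *\<^sub>C x) y = inner x (cnj a *\<^sub>C (y::'a::complex_hilbert_space))"
  by (simp add: inner_eq_Re_cinner cinner_scaleC_left cinner_scaleC_right)

lemma norm_scaleC: "norm (a *\<^sub>C x) = cmod a * norm (x::'a::complex_hilbert_space)"
proof -
  have "(norm (a *\<^sub>C x))\<^sup>2 = inner x ((cnj a * a) *\<^sub>C x)"
    by (simp add: power2_norm_eq_inner inner_scaleC_left scaleC_scaleC)
  also have "cnj a * a = complex_of_real ((cmod a)\<^sup>2)"
    by (metis complex_norm_square mult.commute)
  also have "inner x (complex_of_real ((cmod a)\<^sup>2) *\<^sub>C x) = (cmod a * norm x)\<^sup>2"
    by (simp only: scaleC_of_real inner_scaleR_right power2_norm_eq_inner power_mult_distrib)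
  finally show ?thesis by (simp add: power2_eq_imp_eq)
qed

lemma bounded_linear_scaleC: "bounded_linear (\<lambda>x::'a::complex_hilbert_space. a *\<^sub>C x)"
proof (rule bounded_linear_intro[of _ "cmod a"])
  show "a *\<^sub>C (r *\<^sub>R x) = r *\<^sub>R (a *\<^sub>C x)" for r and x :: 'a
    by (metis mult.commute scaleC_of_real scaleC_scaleC)
qed (simp_all add: scaleC_add_right norm_scaleC)

lemma bounded_clinearD:
  assumes "bounded_clinear A"
  shows "bounded_linear A" "linear A" "A (a *\<^sub>C x) = a *\<^sub>C A x"
  using assms by (auto simp: bounded_clinear_def bounded_linear.linear)

text \<open>Riesz representation with \<open>S = id\<close> yields an adjoint for the real inner
  product; complex linearity of \<open>A\<close> and the test vector \<open>i x\<close> upgrade it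
  to the complex one.\<close>

lemma cadjoint_exists:
  fixes A :: "'a::complex_hilbert_space \<Rightarrow> 'a"
  assumes A: "bounded_clinear A"
  shows "\<exists>B. \<forall>x y. cinner (A x) y = cinner x (B y)"
proof -
  have "\<exists>z. \<forall>x. inner (A x) y = inner x z" for y
  proof -
    obtain K where K: "\<And>x. norm (A x) \<le> norm x * K"
      using bounded_linear.bounded[OF bounded_clinearD(1)[OF A]] by blast
    have "linear (\<lambda>x. inner (A x) y)"
      using bounded_clinearD(2)[OF A]
      by (intro linearI) (simp_all add: linear_add linear_cmul inner_add_left)
    moreover have "\<bar>inner (A x) y\<bar> \<le> (\<bar>K\<bar> * norm y) * norm (id x)" for x
    proof -
      have "\<bar>inner (A x) y\<bar> \<le> norm (A x) * norm y" by (rule Cauchy_Schwarz_ineq2)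
      also have "\<dots> \<le> (norm x * \<bar>K\<bar>) * norm y"
        by (intro mult_right_mono order_trans[OF K[of x]] mult_left_mono) auto
      finally show ?thesis by (simp add: mult_ac)
    qed
    ultimately obtain z where "\<And>x. inner (A x) y = inner (id x) z"
      using representation_on_range[of id "\<lambda>x. inner (A x) y" "\<bar>K\<bar> * norm y"] linear_id
      by (metis abs_ge_zero mult_nonneg_nonneg norm_ge_zero)
    then show ?thesis by auto
  qed
  then obtain B where B: "\<And>x y. inner (A x) y = inner x (B y)" by metis
  have "cinner (A x) y = cinner x (B y)" for x y
  proof (rule complex_eqI)
    show "Re (cinner (A x) y) = Re (cinner x (B y))"
      using B by (simp add: inner_eq_Re_cinner)
    show "Im (cinner (A x) y) = Im (cinner x (B y))"
      using B[of "\<i> *\<^sub>C x" y] bounded_clinearD(3)[OF A] by (simp add: Im_cinner)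
  qed
  then show ?thesis by blast
qed

lemma inner_right_eqI:
  assumes "\<And>x. inner x a = inner x (b::'a::real_inner)" shows "a = b"
proof -
  have "inner (a - b) (a - b) = 0" using assms[of "a - b"] by (simp add: inner_diff_right)
  then show ?thesis by simp
qed

lemma cinner_cadjoint:
  fixes A :: "'a::complex_hilbert_space \<Rightarrow> 'a"
  assumes A: "bounded_clinear A"
  shows "cinner (A x) y = cinner x (cadjoint A y)"
proof -
  have "\<exists>!B. \<forall>x y. cinner (A x) y = cinner x (B y)"
  proof (rule ex_ex1I[OF cadjoint_exists[OF A]])
    fix B C assume "\<forall>x y. cinner (A x) y = cinner x (B y)" "\<forall>x y. cinner (A x) y = cinner x (C y)"
    then have "cinner x (B y) = cinner x (C y)" for x y by simp
    then have "inner x (B y) = inner x (C y)" for x y by (simp add: inner_eq_Re_cinner)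
    then have "B y = C y" for y by (rule inner_right_eqI)
    then show "B = C" by (rule ext)
  qed
  from theI'[OF this] show ?thesis unfolding cadjoint_def by blast
qed

lemma inner_cadjoint:
  fixes A :: "'a::complex_hilbert_space \<Rightarrow> 'a"
  assumes "bounded_clinear A"
  shows "inner (A x) y = inner x (cadjoint A y)"
  using cinner_cadjoint[OF assms] by (simp add: inner_eq_Re_cinner)

lemma contractionD:
  fixes A :: "'a::complex_hilbert_space \<Rightarrow> 'a"
  assumes "contraction A"
  shows "bounded_clinear A" "norm (A x) \<le> norm x"
proof -
  show A: "bounded_clinear A" using assms by (simp add: contraction_def)
  have "norm (A x) \<le> onorm A * norm x" by (rule onorm[OF bounded_clinearD(1)[OF A]])
  also have "\<dots> \<le> 1 * norm x" using assms by (intro mult_right_mono) (auto simp: contraction_def)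
  finally show "norm (A x) \<le> norm x" by simp
qed

lemma contraction_cadjoint:
  fixes A :: "'a::complex_hilbert_space \<Rightarrow> 'a"
  assumes "contraction A"
  shows "contraction (cadjoint A)"
proof -
  note A = contractionD[OF assms]
  note adj = inner_cadjoint[OF A(1)]
  have add: "cadjoint A (x + y) = cadjoint A x + cadjoint A y" for x y
    by (rule inner_right_eqI) (simp add: adj[symmetric] inner_add_right)
  have scaleC: "cadjoint A (a *\<^sub>C x) = a *\<^sub>C cadjoint A x" for a x
    by (rule inner_right_eqI)
      (metis adj bounded_clinearD(3)[OF A(1)] complex_cnj_cnj inner_scaleC_left)
  have scaleR: "cadjoint A (r *\<^sub>R x) = r *\<^sub>R cadjoint A x" for r x
    by (metis scaleC scaleC_of_real)
  have bound: "norm (cadjoint A x) \<le> norm x" for x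
  proof -
    have "norm (cadjoint A x) * norm (cadjoint A x) = inner (A (cadjoint A x)) x"
      by (simp add: adj power2_norm_eq_inner[symmetric] power2_eq_square)
    also have "\<dots> \<le> norm (cadjoint A x) * norm x"
      using norm_cauchy_schwarz[of "A (cadjoint A x)" x] A(2)[of "cadjoint A x"]
      by (meson mult_right_mono norm_ge_zero order_trans)
    finally show ?thesis by (cases "norm (cadjoint A x) = 0") auto
  qed
  have "bounded_linear (cadjoint A)"
    using bound by (intro bounded_linear_intro[of _ 1] add scaleR) simp
  moreover have "onorm (cadjoint A) \<le> 1" using onorm_bound[of 1 "cadjoint A"] bound by simp
  ultimately show ?thesis by (simp add: contraction_def bounded_clinear_def scaleC)
qed

section \<open>Square roots and defect operators\<close>

text \<open>The coefficients of the binomial series of \<open>sqrt (1 - z)\<close>.\<close>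

definition sqrt_coeff :: "nat \<Rightarrow> real"
  where "sqrt_coeff n = pochhammer (- 1 / 2) n / fact n"

lemma sqrt_coeff_gbinomial: "sqrt_coeff n = (-1) ^ n * ((1/2) gchoose n)"
  by (simp add: sqrt_coeff_def gbinomial_pochhammer flip: power_mult_distrib)

lemma sqrt_coeff_0 [simp]: "sqrt_coeff 0 = 1"
  by (simp add: sqrt_coeff_def)

lemma sqrt_coeff_Suc_nonpos: "sqrt_coeff (Suc n) \<le> 0"
proof -
  have "pochhammer (- 1 / 2 :: real) (Suc n) = (- 1 / 2) * pochhammer (1/2) n"
    by (simp add: pochhammer_rec)
  moreover have "0 \<le> pochhammer (1/2 :: real) n" by (intro pochhammer_nonneg) simp
  ultimately show ?thesis by (simp add: sqrt_coeff_def divide_nonpos_nonneg)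
qed

text \<open>Dividing \<open>(1 - z)^(1/2)\<close> by \<open>1 - z\<close> forms partial sums of
  coefficients, so these are the nonnegative coefficients of \<open>(1 - z)^(-1/2)\<close>.\<close>

lemma sum_sqrt_coeff_nonneg: "0 \<le> (\<Sum>k\<le>n. sqrt_coeff k)"
proof -
  have "(\<Sum>k\<le>n. sqrt_coeff k) = (\<Sum>k\<le>n. ((1/2) gchoose k) * (-1) ^ k)"
    by (simp add: sqrt_coeff_gbinomial mult.commute)
  also have "\<dots> = (-1) ^ n * ((1/2 - 1) gchoose n)" by (rule gbinomial_sum_lower_neg)
  also have "\<dots> = pochhammer (1/2) n / fact n"
    by (simp add: gbinomial_pochhammer flip: power_mult_distrib)
  also have "\<dots> \<ge> 0" by (intro divide_nonneg_nonneg pochhammer_nonneg) auto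
  finally show ?thesis .
qed

text \<open>Only the zeroth coefficient is positive, so nonnegative partial sums bound the total
  size of the others by 1. Absolute convergence at radius one lets the series act on every
  contraction.\<close>

lemma summable_abs_sqrt_coeff: "summable (\<lambda>n. \<bar>sqrt_coeff n\<bar>)"
proof -
  have "(\<Sum>k<n. \<bar>sqrt_coeff (Suc k)\<bar>) \<le> 1" for n
  proof -
    have "(\<Sum>k<n. \<bar>sqrt_coeff (Suc k)\<bar>) = - (\<Sum>k<n. sqrt_coeff (Suc k))"
      using sqrt_coeff_Suc_nonpos by (simp add: abs_of_nonpos sum_negf)
    also have "\<dots> = 1 - (\<Sum>k\<le>n. sqrt_coeff k)"
      unfolding lessThan_Suc_atMost[symmetric] sum.lessThan_Suc_shift by simp
    also have "\<dots> \<le> 1" using sum_sqrt_coeff_nonneg[of n] by simp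
    finally show ?thesis .
  qed
  then have "summable (\<lambda>n. \<bar>sqrt_coeff (Suc n)\<bar>)" by (intro summableI_nonneg_bounded) auto
  then show ?thesis using summable_Suc_iff[of "\<lambda>n. \<bar>sqrt_coeff n\<bar>"] by simp
qed

text \<open>The square of \<open>sqrt (1 - z)\<close> is \<open>1 - z\<close>, read off
  coefficientwise from the Vandermonde convolution with \<open>1/2 + 1/2 = 1\<close>.\<close>

lemma sqrt_coeff_convolution:
  "(\<Sum>i\<le>n. sqrt_coeff i * sqrt_coeff (n - i)) = (if n = 0 then 1 else if n = 1 then -1 else 0)"
proof -
  have "(\<Sum>i\<le>n. sqrt_coeff i * sqrt_coeff (n - i))
      = (\<Sum>i\<le>n. (-1) ^ n * (((1/2) gchoose i) * ((1/2) gchoose (n - i))))"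
  proof (intro sum.cong refl)
    fix i assume "i \<in> {..n}"
    then have "(-1 :: real) ^ n = (-1) ^ i * (-1) ^ (n - i)" by (simp flip: power_add)
    then show "sqrt_coeff i * sqrt_coeff (n - i)
        = (-1) ^ n * (((1/2) gchoose i) * ((1/2) gchoose (n - i)))"
      by (simp add: sqrt_coeff_gbinomial mult_ac)
  qed
  also have "\<dots> = (-1) ^ n * ((1/2 + 1/2 :: real) gchoose n)"
    using gbinomial_Vandermonde[of "1/2 :: real" "1/2" n]
    by (simp add: atMost_atLeast0 flip: sum_distrib_left)
  also have "(1/2 + 1/2 :: real) gchoose n = of_nat (1 choose n)"
    by (simp add: binomial_gbinomial)
  also have "(-1) ^ n * real (1 choose n) = (if n = 0 then 1 else if n = 1 then -1 else 0)"
    by (auto simp: binomial_eq_0)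
  finally show ?thesis .
qed

section \<open>The square root of I - C as a power series in a contraction C\<close>

definition sqrt_series :: "('a::banach \<Rightarrow> 'a) \<Rightarrow> 'a \<Rightarrow> 'a"
  where "sqrt_series C x = (\<Sum>n. sqrt_coeff n *\<^sub>R (C ^^ n) x)"

lemma linear_funpow: "linear A \<Longrightarrow> linear (A ^^ n)"
  for A :: "'a::real_vector \<Rightarrow> 'a"
proof (induction n)
  case 0
  show ?case using linear_id by (simp add: id_def)
next
  case (Suc n)
  then show ?case using linear_compose[of "A ^^ n" A] by (simp add: o_def)
qed

lemma norm_funpow_le:
  fixes A :: "'a::real_normed_vector \<Rightarrow> 'a"
  assumes "\<And>x. norm (A x) \<le> norm x"
  shows "norm ((A ^^ n) x) \<le> norm x"
proof (induction n)
  case (Suc n)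
  then show ?case using assms[of "(A ^^ n) x"] by simp
qed simp

lemma inner_funpow_adjoint:
  fixes A B :: "'a::real_inner \<Rightarrow> 'a"
  assumes "\<And>x y. inner (A x) y = inner x (B y)"
  shows "inner ((A ^^ n) x) y = inner x ((B ^^ n) y)"
  by (induction n arbitrary: y) (simp_all add: assms, metis funpow_swap1)

lemma funpow_commute:
  assumes "\<And>x. E (A x) = A (E x)" shows "E ((A ^^ n) x) = (A ^^ n) (E x)"
  by (induction n) (simp_all add: assms)

context
  fixes C :: "'a::banach \<Rightarrow> 'a"
  assumes C: "linear C" and C_norm: "\<And>x. norm (C x) \<le> norm x"
begin

lemma sqrt_series_term_bound: "norm (sqrt_coeff n *\<^sub>R (C ^^ n) x) \<le> \<bar>sqrt_coeff n\<bar> * norm x"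
  using norm_funpow_le[OF C_norm] by (simp add: mult_left_mono)

lemma summable_sqrt_series: "summable (\<lambda>n. sqrt_coeff n *\<^sub>R (C ^^ n) x)"
  by (rule summable_comparison_test[OF _ summable_mult2[OF summable_abs_sqrt_coeff, of "norm x"]])
    (use sqrt_series_term_bound in blast)

lemma sqrt_series_sums: "(\<lambda>n. sqrt_coeff n *\<^sub>R (C ^^ n) x) sums sqrt_series C x"
  unfolding sqrt_series_def using summable_sqrt_series by (rule summable_sums)

lemma bounded_linear_sqrt_series: "bounded_linear (sqrt_series C)"
proof (rule bounded_linear_intro)
  show "sqrt_series C (x + y) = sqrt_series C x + sqrt_series C y" for x y
    using sums_add[OF sqrt_series_sums sqrt_series_sums, of x y] linear_funpow[OF C]
    by (intro sums_unique2[OF sqrt_series_sums]) (simp add: linear_add scaleR_add_right)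
  show "sqrt_series C (r *\<^sub>R x) = r *\<^sub>R sqrt_series C x" for r x
    using sums_scaleR_right[OF sqrt_series_sums, of r x] linear_funpow[OF C]
    by (intro sums_unique2[OF sqrt_series_sums]) (simp add: linear_cmul mult.commute)
  show "norm (sqrt_series C x) \<le> norm x * (\<Sum>n. \<bar>sqrt_coeff n\<bar>)" for x
  proof -
    have "norm (sqrt_series C x) \<le> (\<Sum>n. \<bar>sqrt_coeff n\<bar> * norm x)"
      unfolding sqrt_series_def
      by (intro norm_suminf_le sqrt_series_term_bound summable_mult2 summable_abs_sqrt_coeff)
    then show ?thesis by (simp add: suminf_mult2[OF summable_abs_sqrt_coeff, symmetric] mult.commute[of "norm x"])
  qed
qed

lemma sqrt_series_commute:
  assumes E: "bounded_linear E" and EC: "\<And>x. E (C x) = C (E x)"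
  shows "E (sqrt_series C x) = sqrt_series C (E x)"
  using bounded_linear.sums[OF E sqrt_series_sums, of x]
  by (intro sums_unique2[OF _ sqrt_series_sums])
    (simp add: linear_cmul[OF bounded_linear.linear[OF E]] funpow_commute[of E C, OF EC])

text \<open>A Cauchy product for operators. Applying partial sums twice runs over a square of index
  pairs; the triangle \<open>i + j < N\<close> collapses to \<open>x - C x\<close> by the
  convolution identity. The remaining corner is dominated by the corresponding corner for the
  absolute coefficients, which vanishes in the limit.\<close>

lemma sqrt_series_square: "sqrt_series C (sqrt_series C x) = x - C x"
proof -
  let ?c = sqrt_coeff
  define B where "B = (\<Sum>n. \<bar>?c n\<bar>)"
  define S where "S N y = (\<Sum>n<N. ?c n *\<^sub>R (C ^^ n) y)" for N y
  have S_lim: "(\<lambda>N. S N y) \<longlonglongrightarrow> sqrt_series C y" for y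
    using sqrt_series_sums[of y] by (simp add: sums_def S_def)
  have S_diff: "S N (y - z) = S N y - S N z" for N y z
    by (simp add: S_def linear_diff[OF linear_funpow[OF C]] scaleR_diff_right sum_subtractf)
  have S_bound: "norm (S N y) \<le> B * norm y" for N y
  proof -
    have "norm (S N y) \<le> (\<Sum>n<N. \<bar>?c n\<bar> * norm y)"
      unfolding S_def by (intro sum_norm_le sqrt_series_term_bound)
    also have "\<dots> \<le> B * norm y"
      unfolding B_def sum_distrib_right[symmetric]
      by (intro mult_right_mono sum_le_suminf summable_abs_sqrt_coeff) auto
    finally show ?thesis .
  qed
  \<comment> \<open>The bound \<open>B\<close>, uniform in \<open>N\<close>, allows the inner and
    the outer limit to be taken along the same \<open>N\<close>.\<close>
  have "(\<lambda>N. S N (S N x - sqrt_series C x)) \<longlonglongrightarrow> 0"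
  proof (rule Lim_null_comparison)
    show "\<forall>\<^sub>F N in sequentially. norm (S N (S N x - sqrt_series C x))
        \<le> B * norm (S N x - sqrt_series C x)"
      using S_bound by simp
    have "(\<lambda>N. B * norm (S N x - sqrt_series C x)) \<longlonglongrightarrow> B * norm (sqrt_series C x - sqrt_series C x)"
      by (intro tendsto_intros S_lim)
    then show "(\<lambda>N. B * norm (S N x - sqrt_series C x)) \<longlonglongrightarrow> 0" by simp
  qed
  from tendsto_add[OF this S_lim[of "sqrt_series C x"]]
  have lim1: "(\<lambda>N. S N (S N x)) \<longlonglongrightarrow> sqrt_series C (sqrt_series C x)"
    by (simp add: S_diff)
  define tri where "tri N = {(i, j). i + j < (N::nat)}" for N
  have tri_sub: "tri N \<subseteq> {..<N} \<times> {..<N}" for N by (auto simp: tri_def)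
  have square: "S N (S N x) = (\<Sum>(i, j)\<in>{..<N} \<times> {..<N}. (?c i * ?c j) *\<^sub>R (C ^^ (i + j)) x)" for N
    by (simp add: S_def linear_sum[OF linear_funpow[OF C]] linear_cmul[OF linear_funpow[OF C]]
        scaleR_sum_right sum.cartesian_product funpow_add)
  have triangle: "(\<Sum>(i, j)\<in>tri N. (?c i * ?c j) *\<^sub>R (C ^^ (i + j)) x) = x - C x" if "2 \<le> N" for N
  proof -
    have "(\<Sum>(i, j)\<in>tri N. (?c i * ?c j) *\<^sub>R (C ^^ (i + j)) x)
        = (\<Sum>n<N. \<Sum>i\<le>n. (?c i * ?c (n - i)) *\<^sub>R (C ^^ n) x)"
      unfolding tri_def sum.triangle_reindex by (intro sum.cong) auto
    also have "\<dots> = (\<Sum>n<N. (if n = 0 then 1 else if n = 1 then -1 else 0) *\<^sub>R (C ^^ n) x)"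
      by (simp only: scaleR_sum_left[symmetric] sqrt_coeff_convolution)
    also have "\<dots> = (\<Sum>n\<in>{0, 1}. (if n = 0 then 1 else if n = 1 then -1 else 0) *\<^sub>R (C ^^ n) x)"
      using that by (intro sum.mono_neutral_right) auto
    finally show ?thesis by simp
  qed
  \<comment> \<open>\<open>d N\<close> is the sum of the absolute coefficient products over the
    corner of the square outside the triangle.\<close>
  define d where "d N = (\<Sum>i<N. \<bar>?c i\<bar>) * (\<Sum>j<N. \<bar>?c j\<bar>)
      - (\<Sum>n<N. \<Sum>i\<le>n. \<bar>?c i\<bar> * \<bar>?c (n - i)\<bar>)" for N
  have err: "norm (S N (S N x) - (x - C x)) \<le> d N * norm x" if "2 \<le> N" for N
  proof -
    have "S N (S N x) - (x - C x)
        = (\<Sum>(i, j)\<in>{..<N} \<times> {..<N} - tri N. (?c i * ?c j) *\<^sub>R (C ^^ (i + j)) x)"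
      unfolding square triangle[OF that, symmetric] by (rule sum_diff[OF _ tri_sub, symmetric]) simp
    also have "norm \<dots> \<le> (\<Sum>(i, j)\<in>{..<N} \<times> {..<N} - tri N. \<bar>?c i\<bar> * \<bar>?c j\<bar> * norm x)"
      using norm_funpow_le[OF C_norm]
      by (intro sum_norm_le) (auto simp: abs_mult intro!: mult_left_mono)
    also have "\<dots> = ((\<Sum>(i, j)\<in>{..<N} \<times> {..<N}. \<bar>?c i\<bar> * \<bar>?c j\<bar>)
        - (\<Sum>(i, j)\<in>tri N. \<bar>?c i\<bar> * \<bar>?c j\<bar>)) * norm x"
      by (subst sum_diff[OF _ tri_sub, symmetric]) (auto simp: sum_distrib_right case_prod_unfold)
    also have "\<dots> = d N * norm x"
      unfolding d_def tri_def sum.triangle_reindex sum_product sum.cartesian_product ..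
    finally show ?thesis .
  qed
  have "d \<longlonglongrightarrow> B * B - B * B"
  proof -
    have "(\<lambda>n. \<Sum>i\<le>n. \<bar>?c i\<bar> * \<bar>?c (n - i)\<bar>) sums (B * B)"
      unfolding B_def by (rule Cauchy_product_sums) (simp_all add: summable_abs_sqrt_coeff)
    then have conv: "(\<lambda>N. \<Sum>n<N. \<Sum>i\<le>n. \<bar>?c i\<bar> * \<bar>?c (n - i)\<bar>) \<longlonglongrightarrow> B * B"
      by (simp add: sums_def)
    have "(\<lambda>N. \<Sum>n<N. \<bar>?c n\<bar>) \<longlonglongrightarrow> B"
      using summable_sums[OF summable_abs_sqrt_coeff] by (simp add: sums_def B_def)
    then show ?thesis unfolding d_def by (intro tendsto_intros conv)
  qed
  then have "(\<lambda>N. d N * norm x) \<longlonglongrightarrow> 0" by (simp add: tendsto_mult_left_zero)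
  then have "(\<lambda>N. S N (S N x) - (x - C x)) \<longlonglongrightarrow> 0"
    by (rule Lim_null_comparison[rotated]) (use err in \<open>auto simp: eventually_sequentially\<close>)
  then have "(\<lambda>N. S N (S N x)) \<longlonglongrightarrow> x - C x" by (rule LIM_zero_cancel)
  then show ?thesis using lim1 LIMSEQ_unique by blast
qed

end

lemma sqrt_series_self_adjoint:
  fixes C :: "'a::{real_inner,banach} \<Rightarrow> 'a"
  assumes C: "linear C" and C_norm: "\<And>x. norm (C x) \<le> norm x"
    and adj: "\<And>x y. inner (C x) y = inner x (C y)"
  shows "inner (sqrt_series C x) y = inner x (sqrt_series C y)"
proof -
  have "(\<lambda>n. inner (sqrt_coeff n *\<^sub>R (C ^^ n) x) y) sums inner (sqrt_series C x) y"
    by (rule bounded_linear.sums[OF bounded_linear_inner_left sqrt_series_sums[OF C C_norm]])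
  moreover have "(\<lambda>n. inner x (sqrt_coeff n *\<^sub>R (C ^^ n) y)) sums inner x (sqrt_series C y)"
    by (rule bounded_linear.sums[OF bounded_linear_inner_right sqrt_series_sums[OF C C_norm]])
  ultimately show ?thesis
    using sums_unique2 by (simp add: inner_funpow_adjoint[OF adj])
qed

text \<open>The coefficients after the zeroth are nonpositive and multiply
  \<open>inner ((C ^^ n) x) x\<close>, which is at most \<open>|x|^2\<close>. So each partial sum
  dominates \<open>|x|^2\<close> times a nonnegative partial sum of coefficients.\<close>

lemma sqrt_series_nonneg:
  fixes C :: "'a::{real_inner,banach} \<Rightarrow> 'a"
  assumes C: "linear C" and C_norm: "\<And>x. norm (C x) \<le> norm x"
  shows "0 \<le> inner (sqrt_series C x) x"
proof -
  have "(\<lambda>n. inner (sqrt_coeff n *\<^sub>R (C ^^ n) x) x) sums inner (sqrt_series C x) x"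
    by (rule bounded_linear.sums[OF bounded_linear_inner_left sqrt_series_sums[OF C C_norm]])
  then have "(\<lambda>N. \<Sum>n\<le>N. inner (sqrt_coeff n *\<^sub>R (C ^^ n) x) x) \<longlonglongrightarrow> inner (sqrt_series C x) x"
    by (simp only: sums_def_le)
  moreover have "0 \<le> (\<Sum>n\<le>N. inner (sqrt_coeff n *\<^sub>R (C ^^ n) x) x)" for N
  proof -
    have "0 \<le> (\<Sum>n\<le>N. sqrt_coeff n) * inner x x"
      by (intro mult_nonneg_nonneg sum_sqrt_coeff_nonneg inner_ge_zero)
    also have "\<dots> = (\<Sum>n\<le>N. sqrt_coeff n * inner x x)" by (rule sum_distrib_right)
    also have "\<dots> \<le> (\<Sum>n\<le>N. inner (sqrt_coeff n *\<^sub>R (C ^^ n) x) x)"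
    proof (rule sum_mono)
      fix n
      have "inner ((C ^^ n) x) x \<le> norm ((C ^^ n) x) * norm x" by (rule norm_cauchy_schwarz)
      also have "\<dots> \<le> norm x * norm x"
        by (intro mult_right_mono norm_funpow_le C_norm) auto
      finally have "inner ((C ^^ n) x) x \<le> inner x x"
        by (simp add: power2_norm_eq_inner[symmetric] power2_eq_square)
      then show "sqrt_coeff n * inner x x \<le> inner (sqrt_coeff n *\<^sub>R (C ^^ n) x) x"
        using sqrt_coeff_Suc_nonpos by (cases n) (auto intro: mult_left_mono_neg)
    qed
    finally show ?thesis .
  qed
  ultimately show ?thesis by (intro LIMSEQ_le_const) auto
qed

section \<open>Positive operators and uniqueness of the positive square root\<close>

text \<open>Complex polarisation: the imaginary part of the form vanishes at \<open>x + y\<close>,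
  \<open>x\<close> and \<open>y\<close>, which leaves an identity between the cross terms. Replacing
  \<open>y\<close> by \<open>i y\<close> turns it into symmetry.\<close>

lemma positive_op_self_adjoint:
  fixes B :: "'a::complex_hilbert_space \<Rightarrow> 'a"
  assumes "positive_op B"
  shows "inner (B x) y = inner x (B y)"
proof -
  have B: "bounded_clinear B" and real: "\<And>x. Im (cinner (B x) x) = 0"
    using assms by (auto simp: positive_op_def complex_is_Real_iff)
  note lin = bounded_clinearD[OF B]
  have zero: "inner (\<i> *\<^sub>C B x) x = 0" for x using real[of x] by (simp add: Im_cinner)
  have "inner (\<i> *\<^sub>C B x) y + inner (\<i> *\<^sub>C B y) x = 0" for x y
    using zero[of "x + y"] zero[of x] zero[of y] lin(2)
    by (simp add: linear_add scaleC_add_right inner_add_left inner_add_right)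
  from this[of x "\<i> *\<^sub>C y"] show ?thesis
    by (simp add: lin(3) scaleC_scaleC inner_scaleC_left inner_commute)
qed

text \<open>Perturbing \<open>y\<close> in direction \<open>B y\<close>, the nonnegative form equals
  \<open>2 t |B y|^2\<close> plus a term quadratic in \<open>t\<close>, so the linear coefficient
  must vanish.\<close>

lemma positive_op_zero:
  fixes B :: "'a::complex_hilbert_space \<Rightarrow> 'a"
  assumes B: "positive_op B" and "inner (B y) y = 0"
  shows "B y = 0"
proof -
  have lin: "linear B" using B bounded_clinearD(2) by (auto simp: positive_op_def)
  have nonneg: "0 \<le> inner (B x) x" for x using B by (simp add: positive_op_def inner_eq_Re_cinner)
  define a where "a = (norm (B y))\<^sup>2"
  define b where "b = inner (B (B y)) (B y)"
  have "0 \<le> 2 * t * a + t\<^sup>2 * b" for t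
    unfolding a_def b_def power2_norm_eq_inner
    using nonneg[of "y + t *\<^sub>R B y"] assms(2) lin positive_op_self_adjoint[OF B, of "B y" y]
    by (simp add: linear_add linear_cmul inner_add_left inner_add_right
        power2_eq_square algebra_simps)
  then have "a = 0" by (rule linear_coefficient_zero) (simp add: b_def nonneg)
  then show ?thesis by (simp add: a_def)
qed

text \<open>Uniqueness justifies the definite description in \<open>sqrt_op\<close>: another
  positive root \<open>B\<close> commutes with \<open>C = I - B^2\<close>, hence with the series
  \<open>R\<close>, and then \<open>(B + R) (B - R) = B^2 - R^2 = 0\<close>.\<close>

lemma sqrt_op_eq_sqrt_series:
  fixes C :: "'a::complex_hilbert_space \<Rightarrow> 'a"
  assumes C: "bounded_clinear C" and C_norm: "\<And>x. norm (C x) \<le> norm x"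
    and adj: "\<And>x y. inner (C x) y = inner x (C y)"
  shows "positive_op (sqrt_series C)" "sqrt_op (\<lambda>x. x - C x) = sqrt_series C"
proof -
  let ?R = "sqrt_series C"
  note lin = bounded_clinearD[OF C]
  note R = bounded_linear_sqrt_series[OF lin(2) C_norm]
  have R_scaleC: "?R (a *\<^sub>C x) = a *\<^sub>C ?R x" for a x
    by (rule sqrt_series_commute[OF lin(2) C_norm bounded_linear_scaleC, symmetric]) (simp add: lin(3))
  have R_adj: "inner (?R x) y = inner x (?R y)" for x y
    by (rule sqrt_series_self_adjoint[OF lin(2) C_norm adj])
  have "Im (cinner (?R x) x) = 0" for x
  proof -
    have "inner (\<i> *\<^sub>C ?R x) x = inner (?R x) (- (\<i> *\<^sub>C x))"
      using scaleC_scaleC[of "-1" \<i> x] by (simp add: inner_scaleC_left)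
    also have "\<dots> = - inner (\<i> *\<^sub>C ?R x) x"
      by (simp add: R_adj R_scaleC inner_commute[of "\<i> *\<^sub>C ?R x" x])
    finally show ?thesis by (simp add: Im_cinner)
  qed
  then show pos: "positive_op ?R"
    using R R_scaleC sqrt_series_nonneg[OF lin(2) C_norm]
    by (auto simp: positive_op_def bounded_clinear_def complex_is_Real_iff inner_eq_Re_cinner)
  show "sqrt_op (\<lambda>x. x - C x) = ?R"
    unfolding sqrt_op_def
  proof (rule the_equality)
    show "positive_op ?R \<and> ?R \<circ> ?R = (\<lambda>x. x - C x)"
      using pos by (simp add: fun_eq_iff sqrt_series_square[OF lin(2) C_norm])
  next
    fix B assume asm: "positive_op B \<and> B \<circ> B = (\<lambda>x. x - C x)"
    then have B: "positive_op B" and BB: "\<And>x. B (B x) = x - C x" by (auto simp: fun_eq_iff)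
    have B_lin: "bounded_linear B" "linear B"
      using B bounded_clinearD by (auto simp: positive_op_def)
    have "B (C x) = C (B x)" for x
      using BB[of "B x"] BB[of x] by (simp add: linear_diff[OF B_lin(2)])
    then have BR: "B (?R x) = ?R (B x)" for x
      by (intro sqrt_series_commute[OF lin(2) C_norm B_lin(1)])
    show "B = ?R"
    proof
      fix x
      define y where "y = B x - ?R x"
      \<comment> \<open>The two nonnegative forms add up to zero at \<open>y\<close>, so
        \<open>B y\<close> and \<open>?R y\<close> both vanish; self-adjointness then moves
        \<open>B - ?R\<close> from \<open>x\<close> onto \<open>y\<close>.\<close>
      have "B y + ?R y = 0"
        by (simp add: y_def linear_diff[OF B_lin(2)] linear_diff[OF bounded_linear.linear[OF R]] BR BB
            sqrt_series_square[OF lin(2) C_norm])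
      then have "inner (B y) y + inner (?R y) y = 0" by (metis inner_add_left inner_zero_left)
      moreover have "0 \<le> inner (B y) y" "0 \<le> inner (?R y) y"
        using B pos by (auto simp: positive_op_def inner_eq_Re_cinner)
      ultimately have "B y = 0" "?R y = 0"
        using positive_op_zero[OF B] positive_op_zero[OF pos] by auto
      then have "inner y y = 0"
        using positive_op_self_adjoint[OF B, of x y] R_adj[of x y]
        by (subst y_def) (simp add: inner_diff_left)
      then show "B x = ?R x" by (simp add: y_def)
    qed
  qed
qed

section \<open>Defect operators\<close>

text \<open>The root is identified with the series in \<open>C\<close>, the adjoint of
  \<open>A\<close> composed with \<open>A\<close>. Working with the series gives the commutation
  rule: a bounded operator commuting with \<open>C\<close> commutes with every term.\<close>

lemma defect_op:
  fixes A :: "'a::complex_hilbert_space \<Rightarrow> 'a"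
  assumes A: "contraction A"
  shows bounded_clinear_defect_op: "bounded_clinear (defect_op A)"
    and defect_op_self_adjoint: "inner (defect_op A x) y = inner x (defect_op A y)"
    and defect_op_square: "defect_op A (defect_op A x) = x - cadjoint A (A x)"
    and defect_op_commute: "\<lbrakk>bounded_linear E; \<And>x. E (cadjoint A (A x)) = cadjoint A (A (E x))\<rbrakk>
      \<Longrightarrow> E (defect_op A x) = defect_op A (E x)"
proof -
  define C where "C = (\<lambda>x. cadjoint A (A x))"
  note A1 = contractionD[OF A] and A2 = contractionD[OF contraction_cadjoint[OF A]]
  have C: "bounded_clinear C"
    using bounded_linear_compose[OF bounded_clinearD(1)[OF A2(1)] bounded_clinearD(1)[OF A1(1)]]
    by (simp add: C_def bounded_clinear_def bounded_clinearD(3)[OF A1(1)] bounded_clinearD(3)[OF A2(1)])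
  have norm: "norm (C x) \<le> norm x" for x
    unfolding C_def using A1(2) A2(2) by (meson order_trans)
  have adj: "inner (C x) y = inner x (C y)" for x y
    unfolding C_def by (metis A1(1) inner_cadjoint inner_commute)
  note lin = bounded_clinearD(2)[OF C]
  have eq: "defect_op A = sqrt_series C"
    using sqrt_op_eq_sqrt_series(2)[OF C norm adj] by (simp add: defect_op_def C_def)
  show "bounded_clinear (defect_op A)"
    using sqrt_op_eq_sqrt_series(1)[OF C norm adj] by (simp add: eq positive_op_def)
  show "inner (defect_op A x) y = inner x (defect_op A y)"
    unfolding eq by (rule sqrt_series_self_adjoint[OF lin norm adj])
  show "defect_op A (defect_op A x) = x - cadjoint A (A x)"
    unfolding eq using sqrt_series_square[OF lin norm, of x] by (simp add: C_def)
  show "E (defect_op A x) = defect_op A (E x)"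
    if "bounded_linear E" "\<And>x. E (cadjoint A (A x)) = cadjoint A (A (E x))"
    unfolding eq using sqrt_series_commute[OF lin norm that(1)] that(2) by (simp add: C_def)
qed

lemma norm_defect_op:
  fixes A :: "'a::complex_hilbert_space \<Rightarrow> 'a"
  assumes A: "contraction A"
  shows "(norm (defect_op A x))\<^sup>2 = (norm x)\<^sup>2 - (norm (A x))\<^sup>2"
  by (simp add: power2_norm_eq_inner defect_op_self_adjoint[OF A] defect_op_square[OF A]
      inner_diff_right inner_cadjoint[OF contractionD(1)[OF A]])

section \<open>Shmul'yan domination\<close>

lemma closure_range_representer_unique:
  fixes S :: "'b::real_vector \<Rightarrow> 'a::real_inner"
  assumes S: "linear S" and z: "z \<in> closure (range S)" "z' \<in> closure (range S)"
    and eq: "\<And>x. inner (S x) z = inner (S x) z'"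
  shows "z = z'"
proof -
  have "closure (range S) \<subseteq> {v. inner v (z - z') = 0}"
  proof (rule closure_minimal)
    show "range S \<subseteq> {v. inner v (z - z') = 0}" using eq by (auto simp: inner_diff_right)
    show "closed {v. inner v (z - z') = 0}" by (intro closed_Collect_eq continuous_intros)
  qed
  then have "inner z (z - z') = 0" "inner z' (z - z') = 0" using z by blast+
  then have "inner (z - z') (z - z') = 0" by (simp only: inner_diff_left)
  then show ?thesis by simp
qed

text \<open>The homogeneity rule is that of the real part of a sesquilinear form. Inside the closed
  range the representer of each \<open>y\<close> is unique, and uniqueness transports additivity and
  homogeneity from the form to \<open>G\<close>.\<close>

lemma form_representation:
  fixes S :: "'a::complex_hilbert_space \<Rightarrow> 'a" and \<phi> :: "'a \<Rightarrow> 'a \<Rightarrow> real"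
  assumes S: "bounded_clinear S"
    and lin: "\<And>y. linear (\<phi> y)"
    and add: "\<And>y y' x. \<phi> (y + y') x = \<phi> y x + \<phi> y' x"
    and scaleC: "\<And>a y x. \<phi> (a *\<^sub>C y) x = \<phi> y (cnj a *\<^sub>C x)"
    and bound: "\<And>y x. \<bar>\<phi> y x\<bar> \<le> k y * norm (S x)" and k: "\<And>y. 0 \<le> k y"
  obtains G where "\<And>y. G y \<in> closure (range S)" "\<And>y. norm (G y) \<le> k y"
    "\<And>x y. \<phi> y x = inner (S x) (G y)" "\<And>y y'. G (y + y') = G y + G y'"
    "\<And>a y. G (a *\<^sub>C y) = a *\<^sub>C G y"
proof -
  note S_lin = bounded_clinearD[OF S]
  have "\<forall>y. \<exists>z. z \<in> closure (range S) \<and> norm z \<le> k y \<and> (\<forall>x. \<phi> y x = inner (S x) z)"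
    using representation_on_range[OF S_lin(2) lin bound k] by metis
  then obtain G where G: "\<And>y. G y \<in> closure (range S)" "\<And>y. norm (G y) \<le> k y"
    "\<And>x y. \<phi> y x = inner (S x) (G y)" by metis
  \<comment> \<open>Uniqueness compares representers in the closed range only, so that set must be
    stable under sums and multiples.\<close>
  have "(\<lambda>(u, v). u + v) ` closure (range S \<times> range S) \<subseteq> closure (range S)"
  proof (rule image_closure_subset)
    show "(\<lambda>(u, v). u + v) ` (range S \<times> range S) \<subseteq> closure (range S)"
      using closure_subset[of "range S"]
      by (auto simp: linear_add[OF S_lin(2), symmetric])
  qed (auto intro!: continuous_intros simp: case_prod_unfold)
  then have closure_add: "u + v \<in> closure (range S)"
    if "u \<in> closure (range S)" "v \<in> closure (range S)" for u v
    using that by (auto simp: closure_Times)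
  have "(\<lambda>u. a *\<^sub>C u) ` closure (range S) \<subseteq> closure (range S)" for a
  proof (rule image_closure_subset)
    show "(\<lambda>u. a *\<^sub>C u) ` range S \<subseteq> closure (range S)"
      using closure_subset[of "range S"] by (auto simp: S_lin(3)[symmetric])
  qed (auto intro!: linear_continuous_on bounded_linear_scaleC)
  then have closure_scaleC: "a *\<^sub>C u \<in> closure (range S)" if "u \<in> closure (range S)" for a u
    using that by blast
  have "G (y + y') = G y + G y'" for y y'
  proof (rule closure_range_representer_unique[OF S_lin(2) G(1) closure_add[OF G(1) G(1)]])
    show "inner (S x) (G (y + y')) = inner (S x) (G y + G y')" for x
      by (simp add: inner_add_right G(3)[symmetric] add)
  qed
  moreover have "G (a *\<^sub>C y) = a *\<^sub>C G y" for a y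
  proof (rule closure_range_representer_unique[OF S_lin(2) G(1) closure_scaleC[OF G(1)]])
    show "inner (S x) (G (a *\<^sub>C y)) = inner (S x) (a *\<^sub>C G y)" for x
      using G(3)[of y "cnj a *\<^sub>C x"]
      by (simp add: G(3)[symmetric] scaleC S_lin(3) inner_scaleC_left)
  qed
  ultimately show ?thesis using G that by blast
qed

text \<open>A two-sided Douglas-type factorisation: the form is represented first through
  \<open>?D x\<close>, then through \<open>?Ds y\<close>, and each step uses up one factor of the
  bound.\<close>

lemma shmulyan_dominatesI:
  fixes A B :: "'a::complex_hilbert_space \<Rightarrow> 'a"
  assumes A: "contraction A" and B: "bounded_clinear B" and K: "0 \<le> K"
    and bound: "\<And>x y. \<bar>inner (B x - A x) y\<bar>
      \<le> K * norm (defect_op A x) * norm (defect_op (cadjoint A) y)"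
  shows "shmulyan_dominates A B"
proof -
  let ?D = "defect_op A" and ?Ds = "defect_op (cadjoint A)"
  note As = contraction_cadjoint[OF A]
  note A_lin = bounded_clinearD[OF contractionD(1)[OF A]] and B_lin = bounded_clinearD[OF B]
  have lin: "linear (\<lambda>x. inner (B x - A x) y)" for y
    by (intro linearI) (simp_all add: linear_add[OF A_lin(2)] linear_cmul[OF A_lin(2)]
        linear_add[OF B_lin(2)] linear_cmul[OF B_lin(2)] inner_add_left inner_diff_left algebra_simps)
  have scaleC: "inner (B x - A x) (a *\<^sub>C y) = inner (B (cnj a *\<^sub>C x) - A (cnj a *\<^sub>C x)) y" for a x y
    by (simp add: inner_diff_left A_lin(3) B_lin(3) inner_scaleC_left)
  have bound': "\<bar>inner (B x - A x) y\<bar> \<le> (K * norm (?Ds y)) * norm (?D x)" for x y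
    using bound[of x y] by (simp add: mult_ac)
  \<comment> \<open>Factor out \<open>?D\<close>; the size of \<open>G y\<close> is still controlled
    by \<open>?Ds y\<close>.\<close>
  obtain G where G: "\<And>y. norm (G y) \<le> K * norm (?Ds y)"
    "\<And>x y. inner (B x - A x) y = inner (?D x) (G y)"
    "\<And>y y'. G (y + y') = G y + G y'" "\<And>a y. G (a *\<^sub>C y) = a *\<^sub>C G y"
    by (rule form_representation[OF bounded_clinear_defect_op[OF A], of "\<lambda>y x. inner (B x - A x) y"
          "\<lambda>y. K * norm (?Ds y)"])
      (use lin scaleC bound' K in \<open>auto simp: inner_add_right\<close>)
  have lin': "linear (\<lambda>y. inner (G y) u)" for u
  proof (rule linearI)
    show "inner (G (r *\<^sub>R y)) u = r *\<^sub>R inner (G y) u" for r y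
      using G(4)[of "complex_of_real r" y] by (simp add: scaleC_of_real)
  qed (simp add: G(3) inner_add_left)
  have bound'': "\<bar>inner (G y) u\<bar> \<le> (K * norm u) * norm (?Ds y)" for u y
  proof -
    have "\<bar>inner (G y) u\<bar> \<le> norm (G y) * norm u" by (rule Cauchy_Schwarz_ineq2)
    also have "\<dots> \<le> (K * norm (?Ds y)) * norm u" by (intro mult_right_mono G(1)) simp
    finally show ?thesis by (simp add: mult_ac)
  qed
  have scaleC': "inner (G y) (a *\<^sub>C u) = inner (G (cnj a *\<^sub>C y)) u" for y a u
    by (simp add: G(4) inner_scaleC_left)
  \<comment> \<open>Factor out \<open>?Ds\<close>: for fixed \<open>u\<close>, the functional
    sending \<open>y\<close> to \<open>inner (G y) u\<close> is bounded by \<open>|?Ds y|\<close>,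
    and its representer is \<open>X u\<close>.\<close>
  obtain X where X: "\<And>u. X u \<in> closure (range ?Ds)" "\<And>u. norm (X u) \<le> K * norm u"
    "\<And>y u. inner (G y) u = inner (?Ds y) (X u)"
    "\<And>u v. X (u + v) = X u + X v" "\<And>a u. X (a *\<^sub>C u) = a *\<^sub>C X u"
    by (rule form_representation[OF bounded_clinear_defect_op[OF As], of "\<lambda>u y. inner (G y) u"
          "\<lambda>u. K * norm u"])
      (use lin' scaleC' bound'' K in \<open>auto simp: inner_add_right\<close>)
  have "B x - A x = ?Ds (X (?D x))" for x
  proof (rule inner_right_eqI)
    fix y
    have "inner y (B x - A x) = inner (G y) (?D x)" by (metis G(2) inner_commute)
    also have "\<dots> = inner (?Ds y) (X (?D x))" by (rule X(3))
    also have "\<dots> = inner y (?Ds (X (?D x)))" by (rule defect_op_self_adjoint[OF As])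
    finally show "inner y (B x - A x) = inner y (?Ds (X (?D x)))" .
  qed
  then have "B x = A x + ?Ds (X (?D x))" for x by (metis add.commute diff_add_cancel)
  then show ?thesis
    unfolding shmulyan_dominates_def bounded_clinear_between_def defect_space_def
    using X by (intro exI[of _ X]) blast
qed

section \<open>Harnack domination\<close>

lemma bounded_clinear_poly_op:
  fixes A :: "'a::complex_hilbert_space \<Rightarrow> 'a"
  assumes A: "bounded_clinear A"
  shows "bounded_clinear (poly_op p A)"
proof -
  have pow: "bounded_linear (A ^^ k)" "\<And>a x. (A ^^ k) (a *\<^sub>C x) = a *\<^sub>C (A ^^ k) x" for k
  proof (induction k)
    case (Suc k)
    case 1
    show ?case
      using bounded_linear_compose[OF bounded_clinearD(1)[OF A] Suc(1)] by (simp add: o_def)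
    case 2
    show ?case by (simp add: Suc(2) bounded_clinearD(3)[OF A])
  qed (auto simp: id_def bounded_linear_ident)
  have "poly_op p A (a *\<^sub>C x) = a *\<^sub>C poly_op p A x" for a x
    unfolding poly_op_def linear_sum[OF bounded_linear.linear[OF bounded_linear_scaleC]]
    by (intro sum.cong refl) (simp add: pow(2) scaleC_scaleC mult.commute)
  moreover have "bounded_linear (poly_op p A)"
    unfolding poly_op_def
    by (intro bounded_linear_sum bounded_linear_compose[OF bounded_linear_scaleC] pow(1))
  ultimately show ?thesis by (simp add: bounded_clinear_def)
qed

text \<open>Replaces the degree by any bound beyond which the coefficients vanish, so that Fejer
  polynomials can be summed over \<open>k < M\<close>.\<close>

lemma poly_op_eq_sum:
  assumes "\<And>k. M \<le> k \<Longrightarrow> coeff p k = 0"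
  shows "poly_op p A x = (\<Sum>k<M. coeff p k *\<^sub>C (A ^^ k) (x::'a::complex_hilbert_space))"
proof -
  have zero: "0 *\<^sub>C y = (0::'a)" for y using scaleC_of_real[of 0 y] by simp
  have "poly_op p A x = (\<Sum>k<max M (Suc (degree p)). coeff p k *\<^sub>C (A ^^ k) x)"
    unfolding poly_op_def by (intro sum.mono_neutral_left) (auto simp: zero coeff_eq_0)
  also have "\<dots> = (\<Sum>k<M. coeff p k *\<^sub>C (A ^^ k) x)"
    using assms by (intro sum.mono_neutral_right) (auto simp: zero)
  finally show ?thesis .
qed

text \<open>An operator and its real part have the same quadratic form for the real inner product,
  so \<open>Re_op\<close> disappears.\<close>

lemma harnack_dominated_inner:
  fixes T T' :: "'a::complex_hilbert_space \<Rightarrow> 'a"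
  assumes T: "bounded_clinear T" and T': "bounded_clinear T'" and "harnack_dominated T T'"
  obtains c where "1 \<le> c" "\<And>p x. (\<And>z. cmod z \<le> 1 \<Longrightarrow> 0 \<le> Re (poly p z)) \<Longrightarrow>
    inner (poly_op p T x) x \<le> c * inner (poly_op p T' x) x"
proof -
  obtain c where c: "1 \<le> c" and le: "\<And>p. \<forall>z. cmod z \<le> 1 \<longrightarrow> 0 \<le> Re (poly p z) \<Longrightarrow>
      le_op (Re_op (poly_op p T)) (\<lambda>x. c *\<^sub>R Re_op (poly_op p T') x)"
    using assms(3) unfolding harnack_dominated_def by blast
  have Re_op: "inner (Re_op A x) x = inner (A x) x" if "bounded_clinear A"
    for A :: "'a \<Rightarrow> 'a" and x
    using inner_cadjoint[OF that, of x x]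
    by (simp add: Re_op_def inner_add_left inner_commute[of x])
  have "inner (poly_op p T x) x \<le> c * inner (poly_op p T' x) x"
    if "\<And>z. cmod z \<le> 1 \<Longrightarrow> 0 \<le> Re (poly p z)" for p x
  proof -
    have "0 \<le> inner (c *\<^sub>R Re_op (poly_op p T') x - Re_op (poly_op p T) x) x"
      using le[of p] that by (simp add: le_op_def positive_op_def inner_eq_Re_cinner)
    then show ?thesis
      by (simp add: inner_diff_left Re_op bounded_clinear_poly_op T T')
  qed
  with c show ?thesis using that by blast
qed

section \<open>Fejer polynomials averaged over roots of unity\<close>

text \<open>\<open>q\<close> plays the role of the power \<open>a - b\<close> of the root. For
  distinct exponents below \<open>N\<close> it is an \<open>N\<close>-th root of unity other than 1,
  and its geometric sum vanishes.\<close>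

lemma sum_roots_of_unity_orthogonal:
  fixes N a b :: nat
  assumes "a < N" "b < N"
  defines "\<omega> \<equiv> cis (2 * pi / N)"
  shows "(\<Sum>s<N. (\<omega> ^ s) ^ a * cnj (\<omega> ^ s) ^ b) = (if a = b then of_nat N else 0)"
proof -
  define q where "q = \<omega> ^ a * cnj \<omega> ^ b"
  have \<omega>: "\<omega> * cnj \<omega> = 1" by (simp add: \<omega>_def cis_cnj cis_mult)
  have "(\<Sum>s<N. (\<omega> ^ s) ^ a * cnj (\<omega> ^ s) ^ b) = (\<Sum>s<N. q ^ s)"
    by (simp add: q_def power_mult_distrib mult.commute flip: power_mult)
  also have "\<dots> = (if a = b then of_nat N else 0)"
  proof (cases "a = b")
    case True
    then show ?thesis using \<omega> by (simp add: q_def flip: power_mult_distrib)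
  next
    case False
    have "q \<noteq> 1"
    proof
      assume "q = 1"
      then have "\<omega> ^ b = \<omega> ^ a * (\<omega> * cnj \<omega>) ^ b" by (simp add: q_def power_mult_distrib mult_ac)
      then have "\<omega> ^ a = \<omega> ^ b" by (simp add: \<omega>)
      moreover have "\<omega> ^ k = cis (2 * pi * real k / real N)" for k
        unfolding \<omega>_def Complex.DeMoivre by (rule arg_cong[of _ _ cis]) simp
      ultimately show False
        using inj_onD[OF bij_betw_imp_inj_on[OF Complex.bij_betw_roots_unity[of N]], of a b]
          assms(1,2) False by auto
    qed
    moreover have "q ^ N = 1"
    proof -
      have "\<omega> ^ N = 1" using assms by (simp add: \<omega>_def Complex.DeMoivre)
      then have "cnj \<omega> ^ N = 1" by (metis complex_cnj_one complex_cnj_power)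
      have "q ^ N = (\<omega> ^ N) ^ a * (cnj \<omega> ^ N) ^ b"
        by (simp add: q_def power_mult_distrib mult.commute flip: power_mult)
      then show ?thesis using \<open>\<omega> ^ N = 1\<close> \<open>cnj \<omega> ^ N = 1\<close> by simp
    qed
    ultimately show ?thesis using False by (simp add: sum_gp_strict)
  qed
  finally show ?thesis .
qed

text \<open>\<open>M\<close> times the Fejer kernel is the real part of the polynomial with these coefficients.\<close>

definition fejer_weight :: "nat \<Rightarrow> nat \<Rightarrow> real"
  where "fejer_weight M k = 2 * (real M - real k) - (if k = 0 then real M else 0)"

text \<open>By induction \<open>q M\<close> dominates \<open>|s M|^2\<close>. Since
  \<open>s (Suc M) = 1 + z * s M\<close>, both sides grow by \<open>2 * Re (s (Suc M)) - 1\<close>,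
  except that on the left the old term is also multiplied by \<open>|z|^2 \<le> 1\<close>. On the
  unit circle this is an equality.\<close>

lemma fejer_nonneg:
  fixes z :: complex
  assumes "cmod z \<le> 1"
  shows "0 \<le> (\<Sum>k<M. fejer_weight M k * Re (z ^ k))"
proof -
  define s where "s M = (\<Sum>k<M. z ^ k)" for M
  define q where "q M = 2 * (\<Sum>k<M. (real M - real k) * Re (z ^ k)) - real M" for M
  have "(cmod (s M))\<^sup>2 \<le> q M"
  proof (induction M)
    case 0
    show ?case by (simp add: s_def q_def)
  next
    case (Suc M)
    have s_Suc: "s (Suc M) = 1 + z * s M"
      unfolding s_def by (subst sum.lessThan_Suc_shift) (simp add: sum_distrib_left)
    have "(\<Sum>k<Suc M. (real (Suc M) - real k) * Re (z ^ k))
        = (\<Sum>k<Suc M. (real M - real k) * Re (z ^ k)) + (\<Sum>k<Suc M. Re (z ^ k))"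
      unfolding sum.distrib[symmetric] by (intro sum.cong) (auto simp: algebra_simps)
    then have "q (Suc M) = q M + 2 * Re (s (Suc M)) - 1"
      by (simp add: q_def s_def)
    moreover have "(cmod (s (Suc M)))\<^sup>2 = 2 * Re (s (Suc M)) - 1 + (cmod (z * s M))\<^sup>2"
      unfolding s_Suc by (simp only: cmod_power2) (simp add: power2_eq_square algebra_simps)
    moreover have "(cmod (z * s M))\<^sup>2 \<le> (cmod (s M))\<^sup>2"
      using assms by (intro power_mono) (auto simp: norm_mult intro: mult_left_le_one_le)
    ultimately show ?case using Suc.IH by linarith
  qed
  moreover have "(\<Sum>k<M. fejer_weight M k * Re (z ^ k)) = q M"
  proof -
    have "(\<Sum>k<M. fejer_weight M k * Re (z ^ k))
        = (\<Sum>k<M. 2 * ((real M - real k) * Re (z ^ k))) - (\<Sum>k<M. if k = 0 then real M else 0)"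
      unfolding sum_subtractf[symmetric]
      by (intro sum.cong) (auto simp: fejer_weight_def algebra_simps)
    also have "\<dots> = q M" by (simp add: q_def sum_distrib_left)
    finally show ?thesis .
  qed
  ultimately show ?thesis using zero_le_power2[of "cmod (s M)"] by linarith
qed

definition fejer_poly :: "nat \<Rightarrow> complex \<Rightarrow> complex poly"
  where "fejer_poly M \<zeta> = (\<Sum>k<M. monom (complex_of_real (fejer_weight M k) * \<zeta> ^ k) k)"

lemma coeff_fejer_poly:
  "coeff (fejer_poly M \<zeta>) k = (if k < M then complex_of_real (fejer_weight M k) * \<zeta> ^ k else 0)"
  by (simp add: fejer_poly_def coeff_sum)

lemma fejer_poly_nonneg:
  assumes "cmod \<zeta> = 1" "cmod z \<le> 1"
  shows "0 \<le> Re (poly (fejer_poly M \<zeta>) z)"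
proof -
  have "poly (fejer_poly M \<zeta>) z = (\<Sum>k<M. complex_of_real (fejer_weight M k) * (\<zeta> * z) ^ k)"
    by (simp add: fejer_poly_def poly_sum poly_monom power_mult_distrib mult.assoc)
  then have "Re (poly (fejer_poly M \<zeta>) z) = (\<Sum>k<M. fejer_weight M k * Re ((\<zeta> * z) ^ k))"
    by simp
  then show ?thesis using fejer_nonneg[of "\<zeta> * z"] assms by (simp add: norm_mult)
qed

text \<open>Discrete Fourier averaging: the summand for \<open>k\<close>, \<open>j\<close>,
  \<open>i\<close> carries the \<open>k + j\<close>-th power of the root and the conjugate of its
  \<open>i\<close>-th power, so only \<open>k = i - j\<close> survives. With \<open>M + L\<close>
  roots these exponents do not wrap around, and \<open>L \<le> M\<close> makes every difference
  \<open>i - j\<close> occur among the \<open>k\<close>.\<close>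

lemma fejer_average:
  fixes T :: "'a::complex_hilbert_space \<Rightarrow> 'a" and h :: "nat \<Rightarrow> 'a"
  assumes T: "bounded_clinear T" and M: "L \<le> M"
  defines "\<omega> \<equiv> cis (2 * pi / real (M + L))"
  defines "x \<equiv> \<lambda>s. \<Sum>j<L. ((\<omega> ^ s) ^ j) *\<^sub>C h j"
  shows "(\<Sum>s<M + L. inner (poly_op (fejer_poly M (\<omega> ^ s)) T (x s)) (x s))
    = real (M + L) * (\<Sum>i<L. \<Sum>j\<le>i. fejer_weight M (i - j) * inner ((T ^^ (i - j)) (h j)) (h i))"
proof -
  let ?N = "M + L"
  have T_pow: "linear (T ^^ k)" "(T ^^ k) (a *\<^sub>C y) = a *\<^sub>C (T ^^ k) y" for k a y
    using linear_funpow[OF bounded_clinearD(2)[OF T]]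
    by (auto simp: funpow_commute[of "\<lambda>x. a *\<^sub>C x" T] bounded_clinearD(3)[OF T])
  have cinner_sum_left: "cinner (sum f S) y = (\<Sum>k\<in>S. cinner (f k) y)"
    if "finite S" for f :: "nat \<Rightarrow> 'a" and S y
    using that
  proof (induction rule: finite_induct)
    case empty
    show ?case using cinner_scaleC_left[of 0 0 y] scaleC_of_real[of 0 "0::'a"] by simp
  qed (simp add: cinner_add_left)
  have cinner_sum_right: "cinner y (sum f S) = (\<Sum>k\<in>S. cinner y (f k))"
    if "finite S" for f :: "nat \<Rightarrow> 'a" and S y
    using cinner_sum_left[OF that, of f y] by (simp add: cinner_commute[of y])
  let ?g = "\<lambda>k j i. complex_of_real (fejer_weight M k) * cinner ((T ^^ k) (h j)) (h i)"
  have expand: "cinner (poly_op (fejer_poly M (\<omega> ^ s)) T (x s)) (x s)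
      = (\<Sum>k<M. \<Sum>j<L. \<Sum>i<L. ?g k j i * ((\<omega> ^ s) ^ (k + j) * cnj (\<omega> ^ s) ^ i))" for s
  proof -
    have "poly_op (fejer_poly M (\<omega> ^ s)) T (x s)
        = (\<Sum>k<M. (complex_of_real (fejer_weight M k) * (\<omega> ^ s) ^ k) *\<^sub>C (T ^^ k) (x s))"
      by (subst poly_op_eq_sum[of M]) (simp_all add: coeff_fejer_poly)
    also have "cinner \<dots> (x s) = (\<Sum>k<M. \<Sum>j<L. \<Sum>i<L.
        ?g k j i * ((\<omega> ^ s) ^ (k + j) * cnj (\<omega> ^ s) ^ i))"
      by (simp add: x_def linear_sum[OF T_pow(1)] T_pow(2) cinner_sum_left cinner_sum_right
          cinner_scaleC_left cinner_scaleC_right sum_distrib_left power_add mult_ac)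
        (subst sum.swap, rule sum.cong[OF refl], rule sum.swap)
    finally show ?thesis .
  qed
  have "(\<Sum>s<?N. cinner (poly_op (fejer_poly M (\<omega> ^ s)) T (x s)) (x s))
      = (\<Sum>k<M. \<Sum>j<L. \<Sum>i<L. ?g k j i * (\<Sum>s<?N. (\<omega> ^ s) ^ (k + j) * cnj (\<omega> ^ s) ^ i))"
    unfolding expand sum_distrib_left
    by (subst sum.swap, rule sum.cong[OF refl], subst sum.swap, rule sum.cong[OF refl], rule sum.swap)
  also have "\<dots> = (\<Sum>k<M. \<Sum>j<L. \<Sum>i<L. if k + j = i then ?g k j i * of_nat ?N else 0)"
    unfolding \<omega>_def by (intro sum.cong refl, subst sum_roots_of_unity_orthogonal) auto
  also have "\<dots> = (\<Sum>i<L. \<Sum>j<L. \<Sum>k<M. if k + j = i then ?g k j i * of_nat ?N else 0)"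
    by (subst sum.swap, subst (2) sum.swap, subst sum.swap, rule refl)
  also have "\<dots> = (\<Sum>i<L. \<Sum>j\<le>i. ?g (i - j) j i * of_nat ?N)"
  proof (rule sum.cong[OF refl])
    fix i assume i: "i \<in> {..<L}"
    have inner_sum: "(\<Sum>k<M. if k + j = i then ?g k j i * of_nat ?N else 0)
        = (if j \<le> i then ?g (i - j) j i * of_nat ?N else 0)" for j
    proof (cases "j \<le> i")
      case True
      then have "k + j = i \<longleftrightarrow> i - j = k" for k by auto
      then show ?thesis using True i M by (simp add: sum.delta')
    qed auto
    have "(\<Sum>j<L. if j \<le> i then ?g (i - j) j i * of_nat ?N else 0) = (\<Sum>j\<le>i. ?g (i - j) j i * of_nat ?N)"
      using i by (intro sum.mono_neutral_cong_right) auto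
    then show "(\<Sum>j<L. \<Sum>k<M. if k + j = i then ?g k j i * of_nat ?N else 0)
        = (\<Sum>j\<le>i. ?g (i - j) j i * of_nat ?N)"
      by (simp only: inner_sum)
  qed
  finally have "(\<Sum>s<?N. cinner (poly_op (fejer_poly M (\<omega> ^ s)) T (x s)) (x s))
      = (\<Sum>i<L. \<Sum>j\<le>i. ?g (i - j) j i * of_nat ?N)" .
  from arg_cong[OF this, of Re] show ?thesis
    by (simp add: inner_eq_Re_cinner sum_distrib_left mult_ac)
qed

section \<open>Toeplitz forms\<close>

text \<open>A pair below the diagonal also stands for its mirror image, whose real part is the same;
  hence the restriction to \<open>j \<le> i\<close> and the factor 2.\<close>

definition toeplitz_form :: "('a::real_inner \<Rightarrow> 'a) \<Rightarrow> nat \<Rightarrow> (nat \<Rightarrow> 'a) \<Rightarrow> real"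
  where "toeplitz_form T L h =
    (\<Sum>i<L. \<Sum>j\<le>i. (if i = j then 1 else 2) * inner ((T ^^ (i - j)) (h j)) (h i))"

text \<open>For fixed \<open>L\<close>, the Fejer weights divided by \<open>M\<close> tend to 1 at
  order 0 and to 2 elsewhere, so the averaged inequalities become Toeplitz inequalities as
  \<open>M\<close> grows, with the same \<open>c\<close>.\<close>

lemma harnack_dominated_toeplitz:
  fixes T T' :: "'a::complex_hilbert_space \<Rightarrow> 'a"
  assumes T: "bounded_clinear T" and T': "bounded_clinear T'" and "harnack_dominated T T'"
  obtains c where "1 \<le> c" "\<And>L h. toeplitz_form T L h \<le> c * toeplitz_form T' L h"
proof -
  obtain c where c: "1 \<le> c" and le: "\<And>p x. (\<And>z. cmod z \<le> 1 \<Longrightarrow> 0 \<le> Re (poly p z)) \<Longrightarrow>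
    inner (poly_op p T x) x \<le> c * inner (poly_op p T' x) x"
    using harnack_dominated_inner[OF assms] by blast
  define F where "F A L h M = (\<Sum>i<L. \<Sum>j\<le>i. fejer_weight M (i - j) * inner ((A ^^ (i - j)) (h j)) (h i))"
    for A :: "'a \<Rightarrow> 'a" and L h M
  have F_le: "F T L h M \<le> c * F T' L h M" if "L \<le> M" "0 < M" for L h M
  proof -
    let ?\<omega> = "cis (2 * pi / real (M + L))"
    have "cmod (?\<omega> ^ s) = 1" for s by (simp add: norm_power)
    note le' = le[OF fejer_poly_nonneg[OF this]]
    have "real (M + L) * F T L h M \<le> c * (real (M + L) * F T' L h M)"
      unfolding F_def fejer_average[OF T that(1), symmetric] fejer_average[OF T' that(1), symmetric]
        sum_distrib_left[of c]
      by (intro sum_mono le')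
    then have "real (M + L) * F T L h M \<le> real (M + L) * (c * F T' L h M)" by (simp add: mult_ac)
    then show ?thesis using that by (simp add: mult_le_cancel_left)
  qed
  have weight: "(\<lambda>M. fejer_weight M k / real M) \<longlonglongrightarrow> (if k = 0 then 1 else 2)" for k
  proof -
    have "(\<lambda>M. 2 * (1 - real k * (1 / real M)) - (if k = 0 then 1 else 0)) \<longlonglongrightarrow>
        2 * (1 - real k * 0) - (if k = 0 then 1 else 0)"
      by (intro tendsto_intros lim_const_over_n)
    moreover have "\<forall>\<^sub>F M in sequentially. 2 * (1 - real k * (1 / real M)) - (if k = 0 then 1 else 0)
        = fejer_weight M k / real M"
      using eventually_gt_at_top[of 0]
      by eventually_elim (auto simp: fejer_weight_def field_simps)
    ultimately have "(\<lambda>M. fejer_weight M k / real M) \<longlonglongrightarrow> 2 * (1 - real k * 0) - (if k = 0 then 1 else 0)"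
      by (rule Lim_transform_eventually)
    then show ?thesis by (simp split: if_splits)
  qed
  have F_lim: "(\<lambda>M. F A L h M / real M) \<longlonglongrightarrow> toeplitz_form A L h" for A L h
  proof -
    have "(\<lambda>M. \<Sum>i<L. \<Sum>j\<le>i. fejer_weight M (i - j) / real M * inner ((A ^^ (i - j)) (h j)) (h i))
        \<longlonglongrightarrow> (\<Sum>i<L. \<Sum>j\<le>i. (if i - j = 0 then 1 else 2) * inner ((A ^^ (i - j)) (h j)) (h i))"
      by (intro tendsto_sum tendsto_mult_right weight)
    moreover have "(\<Sum>i<L. \<Sum>j\<le>i. (if i - j = 0 then 1 else 2) * inner ((A ^^ (i - j)) (h j)) (h i))
        = toeplitz_form A L h"
      unfolding toeplitz_form_def by (intro sum.cong refl) auto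
    ultimately show ?thesis by (simp add: F_def sum_divide_distrib)
  qed
  have "toeplitz_form T L h \<le> c * toeplitz_form T' L h" for L h
  proof (rule LIMSEQ_le[OF F_lim tendsto_mult_left[OF F_lim]])
    have "F T L h M / real M \<le> c * (F T' L h M / real M)" if "Suc L \<le> M" for M
      using divide_right_mono[OF F_le[of L M h], of "real M"] that by simp
    then show "\<exists>N. \<forall>M\<ge>N. F T L h M / real M \<le> c * (F T' L h M / real M)" by blast
  qed
  with c show ?thesis using that by blast
qed

section \<open>The operator estimate\<close>

text \<open>Along an antidiagonal the mixed second difference of \<open>b\<close> sums to
  \<open>B n - 2 B (n+1) + B (n+2)\<close>, up to entries with a zero index. Both contributions
  telescope in \<open>n\<close>.\<close>

lemma sum_diagonal_second_difference:
  fixes b :: "nat \<Rightarrow> nat \<Rightarrow> real"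
  defines "B \<equiv> \<lambda>n. \<Sum>j\<le>n. b (n - j) j"
  shows "(\<Sum>n<L. \<Sum>j\<le>n. b (n - j) j - b (Suc (n - j)) j - b (n - j) (Suc j) + b (Suc (n - j)) (Suc j))
    = b 0 0 - B L + B (Suc L) - b 0 (Suc L) - b (Suc L) 0"
proof (induction L)
  case 0
  show ?case by (simp add: B_def)
next
  case (Suc L)
  have 1: "(\<Sum>j\<le>n. b (Suc (n - j)) j) = B (Suc n) - b 0 (Suc n)" for n
  proof -
    have "(\<Sum>j\<le>n. b (Suc (n - j)) j) = (\<Sum>j\<le>n. b (Suc n - j) j)"
      by (intro sum.cong) (auto simp: Suc_diff_le)
    then show ?thesis by (simp add: B_def)
  qed
  have 2: "(\<Sum>j\<le>n. b (n - j) (Suc j)) = B (Suc n) - b (Suc n) 0" for n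
    unfolding B_def by (subst sum.atMost_Suc_shift) simp
  have 3: "(\<Sum>j\<le>n. b (Suc (n - j)) (Suc j)) = B (Suc (Suc n)) - b (Suc (Suc n)) 0 - b 0 (Suc (Suc n))" for n
  proof -
    have "(\<Sum>j\<le>n. b (Suc (n - j)) (Suc j)) = (\<Sum>j\<le>n. b (Suc n - j) (Suc j))"
      by (intro sum.cong) (auto simp: Suc_diff_le)
    also have "\<dots> = (\<Sum>j\<le>Suc n. b (Suc n - j) (Suc j)) - b 0 (Suc (Suc n))" by simp
    finally show ?thesis by (simp only: 2)
  qed
  have "(\<Sum>j\<le>L. b (L - j) j - b (Suc (L - j)) j - b (L - j) (Suc j) + b (Suc (L - j)) (Suc j))
      = B L - (B (Suc L) - b 0 (Suc L)) - (B (Suc L) - b (Suc L) 0)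
        + (B (Suc (Suc L)) - b (Suc (Suc L)) 0 - b 0 (Suc (Suc L)))"
    unfolding sum.distrib sum_subtractf 1 2 3 by (simp add: B_def)
  then show ?case using Suc.IH by simp
qed

text \<open>Summation by parts; the weight \<open>Suc i\<close> counts the indices
  \<open>j \<le> i\<close> in row \<open>i\<close> of the triangular sum.\<close>

lemma sum_weighted_second_difference:
  fixes t :: "nat \<Rightarrow> real"
  shows "(\<Sum>i<L. real (Suc i) * (t i - 2 * t (Suc i) + t (Suc (Suc i))))
    = t 0 - real (Suc L) * t L + real L * t (Suc L)"
  by (induction L) (simp_all add: algebra_simps)

text \<open>\<open>R\<close> is the damped operator \<open>r T\<close> and \<open>Rs\<close> its
  adjoint. Damping makes the boundary terms left by telescoping decay, even those multiplied by
  their index.\<close>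

lemma strict_contraction_estimate:
  fixes T R Rs T' :: "'a::real_inner \<Rightarrow> 'a"
  assumes lin: "linear T" "linear R" "linear Rs" "linear T'"
    and adj: "\<And>x y. inner (R x) y = inner x (Rs y)"
    and r: "0 < r" "r < 1" and R_eq: "\<And>x. R x = r *\<^sub>R T x"
    and R_norm: "\<And>x. norm (R x) \<le> r * norm x" "\<And>x. norm (Rs x) \<le> r * norm x"
    and T'_norm: "\<And>x. norm (T' x) \<le> norm x"
    and comm: "\<And>x. T' (R x) = R (T' x)" "\<And>x. T' (Rs x) = Rs (T' x)"
    and quasi: "\<And>x. Rs (R (R x)) = R (Rs (R x))" "\<And>x. Rs (R (Rs x)) = Rs (Rs (R x))"
    and c: "0 \<le> c" and toeplitz: "\<And>L h. toeplitz_form T L h \<le> c * toeplitz_form T' L h"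
  shows "norm (g - T' (Rs g)) \<le> 2 * c * norm (g - Rs (R g))"
proof -
  define Q where "Q x = Rs (R x)" for x
  define A where "A x = T' (Rs x)" for x
  have linQ: "linear Q" unfolding Q_def using linear_compose[OF lin(2,3)] by (simp add: o_def)
  have linA: "linear A" unfolding A_def using linear_compose[OF lin(3,4)] by (simp add: o_def)
  have Q_norm: "norm (Q x) \<le> r * norm x" for x
  proof -
    have "norm (Q x) \<le> r * norm (R x)" unfolding Q_def by (rule R_norm)
    also have "\<dots> \<le> 1 * (r * norm x)" using r R_norm by (intro mult_mono) auto
    finally show ?thesis by simp
  qed
  have A_norm: "norm (A x) \<le> r * norm x" for x
    unfolding A_def using T'_norm R_norm(2) order_trans by blast
  have pow_norm: "norm ((B ^^ n) x) \<le> r ^ n * norm x"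
    if "\<And>x. norm (B x) \<le> r * norm x" for B :: "'a \<Rightarrow> 'a" and n x
  proof (induction n)
    case (Suc n)
    have "norm ((B ^^ Suc n) x) \<le> r * norm ((B ^^ n) x)" using that by simp
    also have "\<dots> \<le> r * (r ^ n * norm x)" using Suc r by (intro mult_left_mono) auto
    finally show ?case by (simp add: mult_ac)
  qed simp
  have Q_adj: "inner (Q x) y = inner x (Q y)" for x y
    unfolding Q_def by (metis adj inner_commute)
  have QA: "Q (A x) = A (Q x)" for x
    unfolding Q_def A_def using comm quasi by metis
  have QR: "Q (R x) = R (Q x)" for x unfolding Q_def by (rule quasi)
  have QT': "Q (T' x) = T' (Q x)" for x unfolding Q_def using comm by simp
  have inner_R_pow: "inner ((R ^^ n) x) ((R ^^ n) y) = inner ((Q ^^ n) x) y" for n x y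
  proof (induction n arbitrary: x y)
    case (Suc n)
    have "inner ((R ^^ Suc n) x) ((R ^^ Suc n) y) = inner ((R ^^ n) (R x)) ((R ^^ n) (R y))"
      by (simp add: funpow_swap1)
    also have "\<dots> = inner (R ((Q ^^ n) x)) (R y)"
      by (simp add: Suc funpow_commute[of R Q, OF QR[symmetric]])
    also have "\<dots> = inner ((Q ^^ Suc n) x) y"
      using adj[of y "R ((Q ^^ n) x)"] by (simp add: Q_def inner_commute)
    finally show ?case .
  qed simp
  have A_pow: "(A ^^ k) x = (Rs ^^ k) ((T' ^^ k) x)" for k x
  proof (induction k)
    case (Suc k)
    have "(A ^^ Suc k) x = T' (Rs ((Rs ^^ k) ((T' ^^ k) x)))" by (simp add: Suc A_def)
    also have "\<dots> = T' ((Rs ^^ Suc k) ((T' ^^ k) x))" by simp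
    also have "\<dots> = (Rs ^^ Suc k) (T' ((T' ^^ k) x))"
      by (rule funpow_commute[of T' Rs, OF comm(2)])
    finally show ?case by simp
  qed simp
  \<comment> \<open>Double commutation: \<open>j\<close> factors \<open>R\<close> on each side pair
    up into \<open>Q\<close>, and the other \<open>k\<close> on the right move over to join
    \<open>T'\<close> as \<open>A\<close>.\<close>
  have inner_mixed: "inner ((T' ^^ k) ((R ^^ j) x)) ((R ^^ (k + j)) y) = inner ((A ^^ k) ((Q ^^ j) x)) y"
    for k j x y
  proof -
    have T'_pow: "(T' ^^ k) (B z) = B ((T' ^^ k) z)" if "\<And>z. T' (B z) = B (T' z)" for B z
      by (rule funpow_commute[symmetric]) (simp add: that)
    have "(T' ^^ k) ((R ^^ j) x) = (R ^^ j) ((T' ^^ k) x)"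
      by (rule T'_pow) (rule funpow_commute[of T' R, OF comm(1)])
    moreover have "(R ^^ (k + j)) y = (R ^^ j) ((R ^^ k) y)"
      by (simp add: add.commute[of k] funpow_add)
    ultimately have "inner ((T' ^^ k) ((R ^^ j) x)) ((R ^^ (k + j)) y)
        = inner ((Q ^^ j) ((T' ^^ k) x)) ((R ^^ k) y)"
      by (simp only: inner_R_pow)
    also have "(Q ^^ j) ((T' ^^ k) x) = (T' ^^ k) ((Q ^^ j) x)"
      by (rule T'_pow[symmetric]) (rule funpow_commute[of T' Q, OF QT'[symmetric]])
    also have "inner \<dots> ((R ^^ k) y) = inner ((A ^^ k) ((Q ^^ j) x)) y"
      unfolding A_pow by (metis inner_funpow_adjoint[OF adj] inner_commute)
    finally show ?thesis .
  qed
  define f where "f = g - A g"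
  define u where "u = g - Q g"
  \<comment> \<open>As \<open>h = (I - Q) (I - A) g\<close>, the entries of the two Toeplitz forms
    become second differences, of \<open>t\<close> for \<open>T\<close> and of \<open>b\<close> for
    \<open>T'\<close>.\<close>
  define h where "h = f - Q f"
  have h_eq: "h = g - A g - Q g + A (Q g)"
    by (simp add: h_def f_def linear_diff[OF linQ] QA)
  define t where "t i = inner ((Q ^^ i) f) f" for i
  define b where "b k j = inner ((A ^^ k) ((Q ^^ j) g)) h" for k j
  define B where "B n = (\<Sum>j\<le>n. b (n - j) j)" for n
  have lower: "t 0 - real (Suc L) * t L + real L * t (Suc L) \<le> toeplitz_form T L (\<lambda>n. (R ^^ n) h)" for L
  proof -
    have Q_pow: "linear (Q ^^ i)" for i by (rule linear_funpow[OF linQ])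
    have norm_R: "inner ((R ^^ i) h) ((R ^^ i) h) = t i - 2 * t (Suc i) + t (Suc (Suc i))" for i
    proof -
      have "inner ((R ^^ i) h) ((R ^^ i) h) = inner ((Q ^^ i) h) h" by (rule inner_R_pow)
      also have "\<dots> = inner ((Q ^^ i) f) f - inner ((Q ^^ i) f) (Q f) - inner ((Q ^^ i) (Q f)) f
          + inner ((Q ^^ i) (Q f)) (Q f)"
        by (simp add: h_def linear_diff[OF Q_pow] inner_diff_left inner_diff_right)
      also have "\<dots> = t i - 2 * t (Suc i) + t (Suc (Suc i))"
        by (simp add: t_def Q_adj[symmetric] funpow_swap1[of Q])
      finally show ?thesis .
    qed
    \<comment> \<open>The vector \<open>(R ^^ i) h\<close> is \<open>r^(i - j)\<close> times its
      partner, and dividing a squared norm by \<open>r^(i - j) \<le> 1\<close> only increases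
      it.\<close>
    have power_le: "inner ((R ^^ i) h) ((R ^^ i) h) \<le> inner ((T ^^ (i - j)) ((R ^^ j) h)) ((R ^^ i) h)"
      if "j \<le> i" for i j
    proof -
      have R_pow: "(R ^^ k) x = r ^ k *\<^sub>R (T ^^ k) x" for k x
        by (induction k) (simp_all add: R_eq linear_cmul[OF lin(1)])
      have "(R ^^ i) h = (R ^^ (i - j)) ((R ^^ j) h)" using that by (simp flip: funpow_add o_apply[of "R ^^ (i - j)"])
      then have eq: "(R ^^ i) h = r ^ (i - j) *\<^sub>R (T ^^ (i - j)) ((R ^^ j) h)" by (simp only: R_pow)
      have "r ^ (i - j) * inner ((T ^^ (i - j)) ((R ^^ j) h)) ((R ^^ i) h) = inner ((R ^^ i) h) ((R ^^ i) h)"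
        by (subst (2) eq) simp
      moreover have "0 < r ^ (i - j)" "r ^ (i - j) \<le> 1" using r by (auto intro: power_le_one)
      ultimately show ?thesis
        by (metis inner_ge_zero mult_left_le_one_le zero_le_mult_iff less_imp_le not_le)
    qed
    have "t 0 - real (Suc L) * t L + real L * t (Suc L)
        = (\<Sum>i<L. real (Suc i) * inner ((R ^^ i) h) ((R ^^ i) h))"
      unfolding norm_R by (rule sum_weighted_second_difference[symmetric])
    also have "\<dots> = (\<Sum>i<L. \<Sum>j\<le>i. inner ((R ^^ i) h) ((R ^^ i) h))" by simp
    also have "\<dots> \<le> (\<Sum>i<L. \<Sum>j\<le>i. (if i = j then 1 else 2)
        * inner ((T ^^ (i - j)) ((R ^^ j) h)) ((R ^^ i) h))"
    proof (intro sum_mono)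
      fix i j :: nat assume "j \<in> {..i}"
      then have "inner ((R ^^ i) h) ((R ^^ i) h) \<le> inner ((T ^^ (i - j)) ((R ^^ j) h)) ((R ^^ i) h)"
        by (intro power_le) simp
      moreover have "0 \<le> inner ((R ^^ i) h) ((R ^^ i) h)" by simp
      ultimately show "inner ((R ^^ i) h) ((R ^^ i) h)
          \<le> (if i = j then 1 else 2) * inner ((T ^^ (i - j)) ((R ^^ j) h)) ((R ^^ i) h)"
        by (auto simp del: inner_ge_zero)
    qed
    finally show ?thesis by (simp add: toeplitz_form_def)
  qed
  have upper: "toeplitz_form T' L (\<lambda>n. (R ^^ n) h)
      \<le> 2 * (b 0 0 - B L + B (Suc L) - b 0 (Suc L) - b (Suc L) 0)" for L
  proof -
    have power_eq: "inner ((T' ^^ (i - j)) ((R ^^ j) h)) ((R ^^ i) h)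
        = b (i - j) j - b (Suc (i - j)) j - b (i - j) (Suc j) + b (Suc (i - j)) (Suc j)"
      if "j \<le> i" for i j
    proof -
      have lins: "linear (A ^^ (i - j))" "linear (Q ^^ j)" by (rule linear_funpow[OF linA] linear_funpow[OF linQ])+
      have AQ_pow: "(Q ^^ n) (A x) = A ((Q ^^ n) x)" for n x
        by (rule funpow_commute[of A Q, symmetric]) (simp add: QA)
      have "inner ((T' ^^ (i - j)) ((R ^^ j) h)) ((R ^^ i) h) = inner ((A ^^ (i - j)) ((Q ^^ j) h)) h"
        using inner_mixed[of "i - j" j h h] that by simp
      also have "\<dots> = inner ((A ^^ (i - j)) ((Q ^^ j) (g - A g - Q g + A (Q g)))) h"
        by (simp only: h_eq)
      also have "\<dots> = b (i - j) j - b (Suc (i - j)) j - b (i - j) (Suc j) + b (Suc (i - j)) (Suc j)"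
        by (simp add: linear_add[OF lins(1)] linear_add[OF lins(2)] linear_diff[OF lins(1)]
            linear_diff[OF lins(2)] inner_add_left inner_diff_left b_def AQ_pow funpow_swap1)
      finally show ?thesis .
    qed
    \<comment> \<open>Diagonal entries are squared norms, so raising their weight to 2 is allowed;
      uniform weights let the sum telescope.\<close>
    have "toeplitz_form T' L (\<lambda>n. (R ^^ n) h) \<le> (\<Sum>i<L. \<Sum>j\<le>i. 2
        * inner ((T' ^^ (i - j)) ((R ^^ j) h)) ((R ^^ i) h))"
      unfolding toeplitz_form_def by (intro sum_mono) auto
    also have "\<dots> = 2 * (\<Sum>i<L. \<Sum>j\<le>i.
        b (i - j) j - b (Suc (i - j)) j - b (i - j) (Suc j) + b (Suc (i - j)) (Suc j))"
      unfolding sum_distrib_left by (intro sum.cong refl) (simp add: power_eq)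
    also have "\<dots> = 2 * (b 0 0 - B L + B (Suc L) - b 0 (Suc L) - b (Suc L) 0)"
      by (simp only: sum_diagonal_second_difference B_def)
    finally show ?thesis .
  qed
  have nr: "(\<lambda>n. real n * r ^ n) \<longlonglongrightarrow> 0" using powser_times_n_limit_0[of r] r by simp
  have rn: "(\<lambda>n. r ^ n) \<longlonglongrightarrow> 0" using r by (intro LIMSEQ_power_zero) simp
  \<comment> \<open>\<open>t n\<close> decays like \<open>r^n\<close>, which beats the linear
    factors.\<close>
  have t_lim: "(\<lambda>L. t 0 - real (Suc L) * t L + real L * t (Suc L)) \<longlonglongrightarrow> t 0 - 0 + 0"
  proof (intro tendsto_intros)
    have t_bound: "\<bar>t n\<bar> \<le> r ^ n * (norm f)\<^sup>2" for n
    proof -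
      have "\<bar>t n\<bar> \<le> norm ((Q ^^ n) f) * norm f" unfolding t_def by (rule Cauchy_Schwarz_ineq2)
      also have "\<dots> \<le> (r ^ n * norm f) * norm f" by (intro mult_right_mono pow_norm Q_norm) simp
      finally show ?thesis by (simp add: power2_eq_square mult_ac)
    qed
    have "(\<lambda>L. (real L * r ^ L + r ^ L) * (norm f)\<^sup>2) \<longlonglongrightarrow> (0 + 0) * (norm f)\<^sup>2"
      by (intro tendsto_intros nr rn)
    then have lim1: "(\<lambda>L. (real L * r ^ L + r ^ L) * (norm f)\<^sup>2) \<longlonglongrightarrow> 0" by simp
    have bound1: "norm (real (Suc L) * t L) \<le> (real L * r ^ L + r ^ L) * (norm f)\<^sup>2" for L
      using mult_left_mono[OF t_bound[of L], of "real (Suc L)"]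
      by (simp only: real_norm_def abs_mult abs_of_nat) (simp add: algebra_simps)
    show "(\<lambda>L. real (Suc L) * t L) \<longlonglongrightarrow> 0"
      by (rule Lim_null_comparison[OF always_eventually[OF allI[OF bound1]] lim1])
    have "(\<lambda>L. (real L * r ^ L) * (r * (norm f)\<^sup>2)) \<longlonglongrightarrow> 0 * (r * (norm f)\<^sup>2)"
      by (intro tendsto_intros nr)
    then have lim2: "(\<lambda>L. (real L * r ^ L) * (r * (norm f)\<^sup>2)) \<longlonglongrightarrow> 0" by simp
    have bound2: "norm (real L * t (Suc L)) \<le> (real L * r ^ L) * (r * (norm f)\<^sup>2)" for L
      using mult_left_mono[OF t_bound[of "Suc L"], of "real L"]
      by (simp only: real_norm_def abs_mult abs_of_nat) (simp add: algebra_simps)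
    show "(\<lambda>L. real L * t (Suc L)) \<longlonglongrightarrow> 0"
      by (rule Lim_null_comparison[OF always_eventually[OF allI[OF bound2]] lim2])
  qed
  define K where "K = norm g * norm h"
  have b_bound: "\<bar>b k j\<bar> \<le> r ^ (k + j) * K" for k j
  proof -
    have "\<bar>b k j\<bar> \<le> norm ((A ^^ k) ((Q ^^ j) g)) * norm h" unfolding b_def by (rule Cauchy_Schwarz_ineq2)
    also have "\<dots> \<le> (r ^ k * (r ^ j * norm g)) * norm h"
      using r by (intro mult_right_mono order_trans[OF pow_norm[OF A_norm]] mult_left_mono pow_norm Q_norm) auto
    finally show ?thesis by (simp add: K_def power_add mult_ac)
  qed
  \<comment> \<open>Antidiagonal \<open>n\<close> has \<open>n + 1\<close> entries, each at most
    \<open>r^n K\<close> in size.\<close>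
  have B_lim: "B \<longlonglongrightarrow> 0"
  proof (rule Lim_null_comparison)
    have "\<bar>B n\<bar> \<le> (real n * r ^ n + r ^ n) * K" for n
    proof -
      have "\<bar>B n\<bar> \<le> (\<Sum>j\<le>n. \<bar>b (n - j) j\<bar>)" unfolding B_def by (rule sum_abs)
      also have "\<dots> \<le> (\<Sum>j\<le>n. r ^ n * K)"
        using b_bound by (intro sum_mono) (metis atMost_iff le_add_diff_inverse2)
      finally show ?thesis by (simp add: algebra_simps)
    qed
    then show "\<forall>\<^sub>F n in sequentially. norm (B n) \<le> (real n * r ^ n + r ^ n) * K" by simp
    have "(\<lambda>n. (real n * r ^ n + r ^ n) * K) \<longlonglongrightarrow> (0 + 0) * K" by (intro tendsto_intros nr rn)
    then show "(\<lambda>n. (real n * r ^ n + r ^ n) * K) \<longlonglongrightarrow> 0" by simp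
  qed
  have rK: "(\<lambda>n. r ^ n * K) \<longlonglongrightarrow> 0" using tendsto_mult_right[OF rn, of K] by simp
  have b_lim: "(\<lambda>n. b 0 n) \<longlonglongrightarrow> 0" "(\<lambda>n. b n 0) \<longlonglongrightarrow> 0"
    by (rule Lim_null_comparison[OF always_eventually rK]; use b_bound[of 0] b_bound[of _ 0] in simp)+
  have "t 0 - 0 + 0 \<le> c * (2 * (b 0 0 - 0 + 0 - 0 - 0))"
  proof (rule LIMSEQ_le[OF t_lim])
    show "(\<lambda>L. c * (2 * (b 0 0 - B L + B (Suc L) - b 0 (Suc L) - b (Suc L) 0)))
        \<longlonglongrightarrow> c * (2 * (b 0 0 - 0 + 0 - 0 - 0))"
      by (intro tendsto_intros B_lim LIMSEQ_Suc[OF B_lim] LIMSEQ_Suc[OF b_lim(1)] LIMSEQ_Suc[OF b_lim(2)])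
    show "\<exists>N. \<forall>L\<ge>N. t 0 - real (Suc L) * t L + real L * t (Suc L)
        \<le> c * (2 * (b 0 0 - B L + B (Suc L) - b 0 (Suc L) - b (Suc L) 0))"
      using lower toeplitz mult_left_mono[OF upper c] by (blast intro: order_trans)
  qed
  then have "(norm f)\<^sup>2 \<le> 2 * c * inner g h"
    by (simp add: t_def b_def power2_norm_eq_inner mult_ac)
  \<comment> \<open>The self-adjoint \<open>I - Q\<close> moves from \<open>f\<close> to
    \<open>g\<close>. Cauchy-Schwarz then leaves a common factor \<open>norm f\<close> to
    cancel.\<close>
  also have "inner g h = inner u f"
    by (simp add: h_def u_def inner_diff_left inner_diff_right Q_adj)
  also have "2 * c * inner u f \<le> 2 * c * (norm u * norm f)"
    using c by (intro mult_left_mono norm_cauchy_schwarz) auto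
  finally have "norm f * norm f \<le> 2 * c * norm u * norm f" by (simp add: power2_eq_square mult_ac)
  then have "norm f \<le> 2 * c * norm u" using c by (cases "norm f = 0") auto
  then show ?thesis by (simp add: f_def u_def A_def Q_def)
qed

text \<open>The constant in the damped estimate does not depend on \<open>r\<close>, so the estimate
  survives \<open>r\<close> tending to 1.\<close>

lemma contraction_estimate:
  fixes T Ts T' :: "'a::real_inner \<Rightarrow> 'a"
  assumes lin: "linear T" "linear Ts" "linear T'"
    and adj: "\<And>x y. inner (T x) y = inner x (Ts y)"
    and norms: "\<And>x. norm (T x) \<le> norm x" "\<And>x. norm (Ts x) \<le> norm x" "\<And>x. norm (T' x) \<le> norm x"
    and comm: "\<And>x. T' (T x) = T (T' x)" "\<And>x. T' (Ts x) = Ts (T' x)"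
    and quasi: "\<And>x. Ts (T (T x)) = T (Ts (T x))" "\<And>x. Ts (T (Ts x)) = Ts (Ts (T x))"
    and c: "0 \<le> c" and toeplitz: "\<And>L h. toeplitz_form T L h \<le> c * toeplitz_form T' L h"
  shows "norm (g - T' (Ts g)) \<le> 2 * c * norm (g - Ts (T g))"
proof -
  have ineq: "norm (g - r *\<^sub>R T' (Ts g)) \<le> 2 * c * norm (g - (r * r) *\<^sub>R Ts (T g))"
    if r: "0 < r" "r < 1" for r
  proof -
    note cmul = linear_cmul[OF lin(1)] linear_cmul[OF lin(2)] linear_cmul[OF lin(3)]
    have "norm (g - T' (r *\<^sub>R Ts g)) \<le> 2 * c * norm (g - r *\<^sub>R Ts (r *\<^sub>R T g))"
      by (rule strict_contraction_estimate[where T = T and R = "\<lambda>x. r *\<^sub>R T x" and r = r])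
        (use r c norms toeplitz in \<open>simp_all add: lin linear_compose_scale_right adj comm quasi cmul\<close>)
    then show ?thesis by (simp add: cmul)
  qed
  \<comment> \<open>The denominator \<open>n + 2\<close> keeps the damping factor strictly between 0
    and 1, also at \<open>n = 0\<close>.\<close>
  define \<rho> where "\<rho> n = 1 - 1 / real (Suc (Suc n))" for n
  have \<rho>: "\<rho> \<longlonglongrightarrow> 1"
    using tendsto_diff[OF tendsto_const LIMSEQ_Suc[OF LIMSEQ_inverse_real_of_nat], of 1]
    by (simp add: \<rho>_def[abs_def] inverse_eq_divide)
  have "norm (g - 1 *\<^sub>R T' (Ts g)) \<le> 2 * c * norm (g - (1 * 1) *\<^sub>R Ts (T g))"
  proof (rule LIMSEQ_le)
    show "(\<lambda>n. norm (g - \<rho> n *\<^sub>R T' (Ts g))) \<longlonglongrightarrow> norm (g - 1 *\<^sub>R T' (Ts g))"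
      by (intro tendsto_intros \<rho>)
    show "(\<lambda>n. 2 * c * norm (g - (\<rho> n * \<rho> n) *\<^sub>R Ts (T g)))
        \<longlonglongrightarrow> 2 * c * norm (g - (1 * 1) *\<^sub>R Ts (T g))"
      by (intro tendsto_intros \<rho>)
    show "\<exists>N. \<forall>n\<ge>N. norm (g - \<rho> n *\<^sub>R T' (Ts g)) \<le> 2 * c * norm (g - (\<rho> n * \<rho> n) *\<^sub>R Ts (T g))"
      using ineq by (auto simp: \<rho>_def)
  qed
  then show ?thesis by simp
qed

section \<open>Form bounds and comparison of defect operators\<close>

text \<open>For \<open>x = D u\<close>, commutation and self-adjointness move one \<open>D\<close>
  from \<open>u\<close> to \<open>y\<close>, splitting the bound by \<open>D^2\<close> evenly
  between the two arguments. Continuity extends this to the closed range.\<close>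

lemma form_bound_of_commuting:
  fixes D M :: "'a::{real_inner,complete_space} \<Rightarrow> 'a"
  assumes D: "bounded_linear D" and M: "bounded_linear M"
    and adj: "\<And>x y. inner (D x) y = inner x (D y)" and comm: "\<And>x. M (D x) = D (M x)"
    and bound: "\<And>x. norm (M x) \<le> K * norm (D (D x))"
  shows "\<bar>inner (M x) y\<bar> \<le> K * norm (D x) * norm (D y)"
proof -
  \<comment> \<open>The bound forces the kernel of \<open>D\<close> into that of \<open>M\<close>,
    so \<open>x\<close> may be replaced by its projection onto the closed range.\<close>
  obtain z where z: "z \<in> closure (range D)" "D x = D z"
    using kernel_range_decomposition[OF bounded_linear.linear[OF D] adj, of x] by blast
  have "M (x - z) = 0"
    using bound[of "x - z"] z(2) by (simp add: linear_diff[OF bounded_linear.linear[OF D]]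
        linear_0[OF bounded_linear.linear[OF D]])
  then have Mx: "M x = M z" by (simp add: linear_diff[OF bounded_linear.linear[OF M]])
  have "closure (range D) \<subseteq> {v. \<bar>inner (M v) y\<bar> \<le> K * norm (D v) * norm (D y)}"
  proof (rule closure_minimal)
    show "range D \<subseteq> {v. \<bar>inner (M v) y\<bar> \<le> K * norm (D v) * norm (D y)}"
    proof clarify
      fix u
      have "\<bar>inner (M (D u)) y\<bar> = \<bar>inner (M u) (D y)\<bar>" by (simp add: comm adj)
      also have "\<dots> \<le> norm (M u) * norm (D y)" by (rule Cauchy_Schwarz_ineq2)
      also have "\<dots> \<le> (K * norm (D (D u))) * norm (D y)" by (intro mult_right_mono bound) simp
      finally show "\<bar>inner (M (D u)) y\<bar> \<le> K * norm (D (D u)) * norm (D y)" .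
    qed
    show "closed {v. \<bar>inner (M v) y\<bar> \<le> K * norm (D v) * norm (D y)}"
      using bounded_linear.continuous_on[OF M continuous_on_id]
        bounded_linear.continuous_on[OF D continuous_on_id]
      by (intro closed_Collect_le continuous_intros) auto
  qed
  then show ?thesis using z Mx by auto
qed

text \<open>On the closed range of \<open>T\<close> quasi-normality makes
  \<open>|Ts v| = |T v|\<close>. The orthogonal part \<open>y - z\<close> is killed by
  \<open>Ts\<close>, while \<open>T z\<close> and \<open>T (y - z)\<close> are orthogonal, so this
  part can only enlarge \<open>|T y|\<close>.\<close>

lemma quasi_normal_imp_hyponormal:
  fixes T Ts :: "'a::{real_inner,complete_space} \<Rightarrow> 'a"
  assumes T: "bounded_linear T" and Ts: "bounded_linear Ts"
    and adj: "\<And>x y. inner (T x) y = inner x (Ts y)"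
    and quasi: "\<And>x. Ts (T (T x)) = T (Ts (T x))"
  shows "norm (Ts y) \<le> norm (T y)"
proof -
  have adj': "inner (Ts x) y = inner x (T y)" for x y by (metis adj inner_commute)
  obtain z where z: "z \<in> closure (range T)" "Ts y = Ts z" "\<And>x. inner (T x) (y - z) = 0"
    using kernel_range_decomposition[OF bounded_linear.linear[OF T] adj, of y] by blast
  have cont: "continuous_on UNIV T" "continuous_on UNIV Ts"
    using bounded_linear.continuous_on[OF _ continuous_on_id] T Ts by auto
  have cont': "continuous_on UNIV (\<lambda>v. Ts (T v))"
    using bounded_linear.continuous_on[OF Ts cont(1)] .
  have "closure (range T) \<subseteq> {v. norm (Ts v) = norm (T v) \<and> inner (Ts (T v)) (y - z) = 0}"
  proof (rule closure_minimal)
    show "range T \<subseteq> {v. norm (Ts v) = norm (T v) \<and> inner (Ts (T v)) (y - z) = 0}"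
    proof clarify
      fix u
      have "inner (Ts (T u)) (Ts (T u)) = inner (T (T u)) (T (T u))"
        using quasi[of u] by (simp add: adj adj')
      then show "norm (Ts (T u)) = norm (T (T u)) \<and> inner (Ts (T (T u))) (y - z) = 0"
        using quasi[of u] z(3) by (simp add: norm_eq_sqrt_inner)
    qed
    show "closed {v. norm (Ts v) = norm (T v) \<and> inner (Ts (T v)) (y - z) = 0}"
      by (intro closed_Collect_conj closed_Collect_eq continuous_intros cont cont')
  qed
  then have zT: "norm (Ts z) = norm (T z)" and orth: "inner (T z) (T (y - z)) = 0"
    using z(1) by (auto simp: adj')
  have "T y = T z + T (y - z)" using linear_add[OF bounded_linear.linear[OF T], of z "y - z"] by simp
  then have "(norm (T y))\<^sup>2 = (norm (T z))\<^sup>2 + (norm (T (y - z)))\<^sup>2"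
    using orth by (simp add: power2_norm_eq_inner inner_add_left inner_add_right inner_commute)
  then have "(norm (T z))\<^sup>2 \<le> (norm (T y))\<^sup>2" by simp
  then have "norm (T z) \<le> norm (T y)" by (rule power2_le_imp_le) simp
  then show ?thesis using z(2) zT by simp
qed

lemma toeplitz_form_2:
  "toeplitz_form T 2 h = (norm (h 0))\<^sup>2 + (norm (h 1))\<^sup>2 + 2 * inner (T (h 0)) (h 1)"
  unfolding power2_norm_eq_inner by (simp add: toeplitz_form_def numeral_2_eq_2)

text \<open>On the pair \<open>x\<close>, \<open>- T' x\<close> the form of \<open>T'\<close> is
  exactly \<open>|defect_op T' x|^2\<close>, while that of \<open>T\<close> exceeds
  \<open>|defect_op T x|^2\<close> by \<open>|T x - T' x|^2\<close>. The pair with the adjoint of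
  \<open>T'\<close> in first position serves the adjoints.\<close>

lemma defect_op_le_of_toeplitz:
  fixes T T' :: "'a::complex_hilbert_space \<Rightarrow> 'a"
  assumes T: "contraction T" and T': "contraction T'"
    and toeplitz: "\<And>h. toeplitz_form T 2 h \<le> c * toeplitz_form T' 2 h"
  shows "(norm (defect_op T x))\<^sup>2 \<le> c * (norm (defect_op T' x))\<^sup>2"
    and "(norm (defect_op (cadjoint T) x))\<^sup>2 \<le> c * (norm (defect_op (cadjoint T') x))\<^sup>2"
proof -
  have "0 \<le> (norm (T x - T' x))\<^sup>2" by simp
  then have "(norm (defect_op T x))\<^sup>2 \<le> toeplitz_form T 2 (\<lambda>n. if n = 0 then x else - T' x)"
    unfolding toeplitz_form_2 norm_defect_op[OF T] unfolding power2_norm_eq_inner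
    by (simp add: inner_diff_left inner_diff_right inner_commute)
  also have "\<dots> \<le> c * toeplitz_form T' 2 (\<lambda>n. if n = 0 then x else - T' x)" by (rule toeplitz)
  also have "\<dots> = c * (norm (defect_op T' x))\<^sup>2"
    unfolding toeplitz_form_2 norm_defect_op[OF T'] by (simp add: power2_norm_eq_inner)
  finally show "(norm (defect_op T x))\<^sup>2 \<le> c * (norm (defect_op T' x))\<^sup>2" .
  let ?Ts = "cadjoint T" and ?T's = "cadjoint T'"
  let ?h = "\<lambda>n::nat. if n = 0 then - ?T's x else x"
  note adj = inner_cadjoint[OF contractionD(1)[OF T]] inner_cadjoint[OF contractionD(1)[OF T']]
  have neg: "T (- v) = - T v" "T' (- v) = - T' v" for v
    using T T' contractionD(1) bounded_clinearD(2) linear_neg by blast+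
  have "0 \<le> (norm (?Ts x - ?T's x))\<^sup>2" by simp
  then have "(norm (defect_op ?Ts x))\<^sup>2 \<le> toeplitz_form T 2 ?h"
    unfolding toeplitz_form_2 norm_defect_op[OF contraction_cadjoint[OF T]]
    unfolding power2_norm_eq_inner
    by (simp add: neg adj inner_diff_left inner_diff_right inner_commute[of "?Ts x" "?T's x"])
  also have "\<dots> \<le> c * toeplitz_form T' 2 ?h" by (rule toeplitz)
  also have "\<dots> = c * (norm (defect_op ?T's x))\<^sup>2"
    unfolding toeplitz_form_2 norm_defect_op[OF contraction_cadjoint[OF T']]
    by (simp add: neg adj power2_norm_eq_inner)
  finally show "(norm (defect_op ?Ts x))\<^sup>2 \<le> c * (norm (defect_op ?T's x))\<^sup>2" .
qed

section \<open>Assembly of the two form bounds\<close>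

theorem corollary2p12:
  fixes T T' :: "'a::complex_hilbert_space \<Rightarrow> 'a"
  assumes "contraction T" and "contraction T'"
    and "doubly_commuting T T'"
    and "quasi_normal T"
    and "harnack_dominated T T'"
  shows "shmulyan_equivalent T T'"
proof -
  let ?Ts = "cadjoint T" and ?T's = "cadjoint T'"
  let ?D = "defect_op T" and ?Ds = "defect_op ?Ts"
  let ?D' = "defect_op T'" and ?Ds' = "defect_op ?T's"
  note T = assms(1) and T' = assms(2)
  note Ts = contraction_cadjoint[OF T]
  note cl = contractionD(1)[OF T] contractionD(1)[OF Ts] contractionD(1)[OF T']
  note bl = cl[THEN bounded_clinearD(1)] and lin = cl[THEN bounded_clinearD(2)]
  note norms = contractionD(2)[OF T] contractionD(2)[OF Ts] contractionD(2)[OF T']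
  note adj = inner_cadjoint[OF cl(1)] and adj' = inner_cadjoint[OF cl(3)]
  obtain c where c: "1 \<le> c" and toeplitz: "\<And>L h. toeplitz_form T L h \<le> c * toeplitz_form T' L h"
    using harnack_dominated_toeplitz[OF cl(1,3) assms(5)] by blast
  have comm: "T' (T x) = T (T' x)" "T (?T's x) = ?T's (T x)" for x
    using assms(3) by (metis doubly_commuting_def comp_apply)+
  \<comment> \<open>Taking adjoints of \<open>comm(2)\<close> exchanges the roles of
    \<open>T\<close> and \<open>T'\<close>.\<close>
  have comm': "T' (?Ts x) = ?Ts (T' x)" for x
  proof (rule inner_right_eqI)
    fix y
    have "inner y (T' (?Ts x)) = inner (T (?T's y)) x"
      using adj'[of "?Ts x" y] adj[of "?T's y" x] by (simp add: inner_commute)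
    also have "\<dots> = inner y (?Ts (T' x))"
      using adj'[of x "T y"] adj[of y "T' x"] by (simp add: comm(2) inner_commute)
    finally show "inner y (T' (?Ts x)) = inner y (?Ts (T' x))" .
  qed
  have quasi: "?Ts (T (T x)) = T (?Ts (T x))" for x
    using assms(4) by (metis quasi_normal_def comp_apply)
  have quasi': "?Ts (T (?Ts x)) = ?Ts (?Ts (T x))" for x
  proof (rule inner_right_eqI)
    fix y
    have "inner y (?Ts (T (?Ts x))) = inner (T (?Ts (T y))) x"
      using adj[of y "T (?Ts x)"] adj[of "?Ts x" "T y"] adj[of "?Ts (T y)" x]
      by (simp add: inner_commute)
    also have "\<dots> = inner (?Ts (T (T y))) x" by (simp add: quasi)
    also have "\<dots> = inner y (?Ts (?Ts (T x)))"
      using adj[of y "?Ts (T x)"] adj[of "T y" "T x"] adj[of x "T (T y)"] by (simp add: inner_commute)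
    finally show "inner y (?Ts (T (?Ts x))) = inner y (?Ts (?Ts (T x)))" .
  qed
  note D_bl = bounded_clinearD(1)[OF bounded_clinear_defect_op[OF T]]
  note D_adj = defect_op_self_adjoint[OF T]
  define M where "M x = x - T' (?Ts x)" for x
  have M: "bounded_linear M"
    unfolding M_def
    by (intro bounded_linear_sub bounded_linear_ident bounded_linear_compose[OF bl(3)] bl(2))
  have D_comm: "T (?D x) = ?D (T x)" "T' (?D x) = ?D (T' x)" "M (?D x) = ?D (M x)" for x
  proof -
    show "T (?D x) = ?D (T x)" by (rule defect_op_commute[OF T bl(1)]) (simp add: quasi)
    show "T' (?D x) = ?D (T' x)" by (rule defect_op_commute[OF T bl(3)]) (simp add: comm(1) comm')
    show "M (?D x) = ?D (M x)"
      by (rule defect_op_commute[OF T M])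
        (simp add: M_def comm(1) comm' quasi' linear_diff[OF lin(1)] linear_diff[OF lin(2)])
  qed
  have "norm (M x) \<le> 2 * c * norm (?D (?D x))" for x
    unfolding M_def defect_op_square[OF T]
    using contraction_estimate[OF lin adj norms comm(1) comm' quasi quasi' _ toeplitz] c by simp
  then have M_bound: "\<bar>inner (M x) y\<bar> \<le> 2 * c * norm (?D x) * norm (?D y)" for x y
    by (rule form_bound_of_commuting[OF D_bl M D_adj D_comm(3)])
  \<comment> \<open>\<open>M_bound\<close> has \<open>?D\<close> on both sides, whereas Shmul'yan
    domination asks for \<open>?Ds\<close> on the right.\<close>
  have D_le: "norm (?D y) \<le> norm (?Ds y)" for y
  proof -
    have "norm (?Ts y) \<le> norm (T y)" by (rule quasi_normal_imp_hyponormal[OF bl(1,2) adj quasi])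
    then have "(norm (?Ts y))\<^sup>2 \<le> (norm (T y))\<^sup>2" by (intro power_mono) auto
    then have "(norm (?D y))\<^sup>2 \<le> (norm (?Ds y))\<^sup>2"
      by (simp add: norm_defect_op[OF T] norm_defect_op[OF Ts])
    then show ?thesis by (rule power2_le_imp_le) simp
  qed
  \<comment> \<open>The part \<open>2 * c\<close> comes from \<open>M_bound\<close>, the 1 from
    \<open>T'\<close> being a contraction.\<close>
  define K where "K = 2 * c + 1"
  have K: "0 \<le> K" using c by (simp add: K_def)
  have bound: "\<bar>inner (T' x - T x) y\<bar> \<le> K * norm (?D x) * norm (?Ds y)" for x y
  proof -
    \<comment> \<open>Add and subtract \<open>T' (?Ts (T x))\<close>.\<close>
    have "T' x - T x = T' (?D (?D x)) - M (T x)"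
      by (simp add: M_def defect_op_square[OF T] linear_diff[OF lin(3)])
    then have "\<bar>inner (T' x - T x) y\<bar> \<le> \<bar>inner (T' (?D (?D x))) y\<bar> + \<bar>inner (M (T x)) y\<bar>"
      by (simp add: inner_diff_left)
    also have "\<bar>inner (T' (?D (?D x))) y\<bar> = \<bar>inner (T' (?D x)) (?D y)\<bar>"
      by (simp add: D_comm(2) D_adj)
    also have "\<dots> \<le> norm (T' (?D x)) * norm (?D y)" by (rule Cauchy_Schwarz_ineq2)
    also have "\<dots> \<le> norm (?D x) * norm (?D y)" by (intro mult_right_mono norms(3)) simp
    also have "\<bar>inner (M (T x)) y\<bar> \<le> 2 * c * norm (?D (T x)) * norm (?D y)" by (rule M_bound)
    also have "\<dots> \<le> 2 * c * norm (?D x) * norm (?D y)"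
      unfolding D_comm(1)[symmetric] using c by (intro mult_right_mono mult_left_mono norms(1)) auto
    finally have "\<bar>inner (T' x - T x) y\<bar> \<le> K * norm (?D x) * norm (?D y)"
      by (simp add: K_def algebra_simps)
    also have "\<dots> \<le> K * norm (?D x) * norm (?Ds y)"
      using K by (intro mult_left_mono D_le) auto
    finally show ?thesis .
  qed
  have sqrt_le: "a \<le> sqrt c * b" if "a\<^sup>2 \<le> c * b\<^sup>2" "0 \<le> b" for a b
  proof -
    have "a\<^sup>2 \<le> (sqrt c * b)\<^sup>2" using that c by (simp add: power_mult_distrib)
    then show ?thesis by (rule power2_le_imp_le) (use that c in auto)
  qed
  have D_le': "norm (?D x) \<le> sqrt c * norm (?D' x)" "norm (?Ds x) \<le> sqrt c * norm (?Ds' x)" for x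
    using defect_op_le_of_toeplitz[OF T T' toeplitz, of x] by (simp_all add: sqrt_le)
  \<comment> \<open>The form only changes sign; passing from each defect operator of
    \<open>T\<close> to that of \<open>T'\<close> costs \<open>sqrt c\<close>, hence the factor
    \<open>c\<close>.\<close>
  have bound': "\<bar>inner (T x - T' x) y\<bar> \<le> (K * c) * norm (?D' x) * norm (?Ds' y)" for x y
  proof -
    have "\<bar>inner (T x - T' x) y\<bar> = \<bar>inner (T' x - T x) y\<bar>" by (simp add: inner_diff_left)
    also have "\<dots> \<le> K * norm (?D x) * norm (?Ds y)" by (rule bound)
    also have "\<dots> \<le> K * (sqrt c * norm (?D' x)) * (sqrt c * norm (?Ds' y))"
      using K c by (intro mult_mono mult_left_mono D_le') auto
    also have "\<dots> = (K * (sqrt c * sqrt c)) * norm (?D' x) * norm (?Ds' y)" by (simp only: mult_ac)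
    finally show ?thesis using c by simp
  qed
  show ?thesis
    unfolding shmulyan_equivalent_def
    using shmulyan_dominatesI[OF T cl(3) K bound] shmulyan_dominatesI[OF T' cl(1) _ bound'] K c
    by simp
qed

end
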